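(* Let $d\ge 1$ and $H=H_{2d+1}(\mathbb{Z})$. Let $(X,T,H)$ and $(Y,S,H)$ be topological dynamical systems and let $\pi\colon X\to Y$ be a factor map that is not bounded-to-one. Then $\mathrm{ND}_{\varepsilon,\pi}(X)\cap\partial_bH$ is closed and non-empty for every $\varepsilon>0$. In particular, $\mathrm{ND}_\pi(X)\cap\partial_bH$ is a non-empty closed set. Moreover, $$\bigcap_{h\in\mathrm{ND}_\pi(X)\cap\partial_bH}\{h<0\}=\emptyset.$$
   Context: The discrete Heisenberg group $H_{2d+1}(\mathbb{Z})$ is the set of triples $(\vec v,\vec u,t)\in\mathbb{Z}^d\times\mathbb{Z}^d\times\mathbb{Z}$ with product $(\vec v_1,\vec u_1,t_1)(\vec v_2,\vec u_2,t_2)=(\vec v_1+\vec v_2,\vec u_1+\vec u_2,t_1+t_2+\langle\vec v_1,\vec u_2\rangle)$. It is endowed with the Kor\'anyi metric $\rho_K(g,f)=\|gf^{-1}\|$, where $\|(\vec v,\vec u,t)\|^4=(\|\vec v\|_2^2+\|\vec u\|_2^2)^2+(2\langle\vec v,\vec u\rangle-4t)^2$. Its horofunctions (limits of the functions $x\mapsto\rho_K(g_n,x)-\rho_K(g_n,1_H)$ as $g_n\to\infty$) are exactly the functions $$h_{(\vec a,\vec b,c)}(\vec v,\vec u,t)=\langle V(\vec a,\vec b,c),(\vec v,\vec u)\rangle,\quad V(\vec a,\vec b,c)=-\big((\|\vec a\|^2+\|\vec b\|^2)\vec a-c\vec b,\ (\|\vec a\|^2+\|\vec b\|^2)\vec b+c\vec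 a\big),$$ with $(\vec a,\vec b,c)\in\mathbb{R}^{2d+1}$ satisfying $(\|\vec a\|^2+\|\vec b\|^2)^2+c^2=1$. Their set is the border $\partial H$, with the topology of pointwise convergence. The set $\partial_bH$ of Busemann horofunctions consists of the $h_{(\vec a,\vec b,c)}$ with $c=0$. For $h\in\partial H$, $\{h<0\}=\{g\in H:h(g)<0\}$. A topological dynamical system $(X,T,H)$ is a compact metric space $(X,d)$ with a continuous action $T$ of $H$, written $T^g\colon X\to X$, with $T^{1_H}=\mathrm{id}_X$ and $T^{g}\circ T^{g'}=T^{gg'}$. A factor map is a continuous surjection $\pi$ with $\pi\circ T^g=S^g\circ\pi$ for all $g$; it is bounded-to-one if there is $M$ such that every fiber has at most $M$ points. $\mathrm{ND}_{\varepsilon,\pi}(X)$ is the set of $h\in\partial H$ for which there are distinct $x,y\in X$ with $\pi(x)=\pi(y)$ and $d(T^gx,T^gy)\le\varepsilon$ for all $g\in\{h<0\}$; $\mathrm{ND}_\pi(X)=\bigcap_{\varepsilon>0}\mathrm{ND}_{\varepsilon,\pi}(X)$. *)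

theory Defs
  imports "HOL-Analysis.Analysis" "HOL-Algebra.Group"
begin

text \<open>The dimension \<open>d \<ge> 1\<close> is \<open>CARD('n)\<close> for a finite index type \<open>'n\<close>.\<close>

type_synonym 'n heis = "(int ^ 'n) \<times> (int ^ 'n) \<times> int"

definition idot :: "int ^ 'n \<Rightarrow> int ^ 'n \<Rightarrow> int" where
  "idot v u = (\<Sum>i\<in>UNIV. v $ i * u $ i)"

fun hmult :: "'n::finite heis \<Rightarrow> 'n heis \<Rightarrow> 'n heis" where
  "hmult (v1, u1, t1) (v2, u2, t2) = (v1 + v2, u1 + u2, t1 + t2 + idot v1 u2)"

definition Heis :: "('n::finite) heis monoid" where
  "Heis = \<lparr>carrier = UNIV, mult = hmult, one = (0, 0, 0)\<rparr>"

lemma Heis_simps [simp]: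
  "carrier Heis = UNIV" "mult Heis = hmult" "one Heis = (0, 0, 0)"
  by (simp_all add: Heis_def)

lemma idot_simps [simp]:
  "idot 0 u = 0" "idot v 0 = 0"
  "idot (v + w) u = idot v u + idot w u" "idot v (u + w) = idot v u + idot v w"
  "idot (- v) u = - idot v u" "idot v (- u) = - idot v u"
  by (simp_all add: idot_def algebra_simps sum.distrib sum_negf)

lemma group_Heis: "group (Heis :: ('n::finite) heis monoid)"
proof (rule groupI)
  fix x :: "'n heis"
  obtain v u t where x: "x = (v, u, t)" by (cases x)
  have "hmult (- v, - u, - t + idot v u) x = (0, 0, 0)"
    by (simp add: x)
  then show "\<exists>y\<in>carrier Heis. y \<otimes>\<^bsub>Heis\<^esub> x = \<one>\<^bsub>Heis\<^esub>"
    by (auto intro!: exI)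
qed (auto simp: algebra_simps)

lemma inv_Heis: "inv\<^bsub>Heis\<^esub> (v, u, t) = (- v, - u, - t + idot v u)"
  by (rule group.inv_equality[OF group_Heis]) simp_all

definition rvec :: "int ^ 'n \<Rightarrow> real ^ 'n" where
  "rvec v = (\<chi> i. real_of_int (v $ i))"

fun koranyi_norm :: "('n::finite) heis \<Rightarrow> real" where
  "koranyi_norm (v, u, t) =
     root 4 (((norm (rvec v))\<^sup>2 + (norm (rvec u))\<^sup>2)\<^sup>2 + (2 * (rvec v \<bullet> rvec u) - 4 * real_of_int t)\<^sup>2)"

definition koranyi_dist :: "('n::finite) heis \<Rightarrow> 'n heis \<Rightarrow> real" where
  "koranyi_dist g f = koranyi_norm (g \<otimes>\<^bsub>Heis\<^esub> inv\<^bsub>Heis\<^esub> f)"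

text \<open>The border: pointwise limits of \<open>x \<mapsto> \<rho>(g\<^sub>n, x) - \<rho>(g\<^sub>n, 1)\<close> along sequences \<open>g\<^sub>n\<close> tending to
  infinity. Its topology is the subspace topology of the product topology on the type
  \<open>'n heis \<Rightarrow> real\<close>, i.e. pointwise convergence.\<close>

definition border :: "('n::finite heis \<Rightarrow> real) set" where
  "border = {h. \<exists>g :: nat \<Rightarrow> 'n heis.
      filterlim (\<lambda>n. koranyi_dist (g n) \<one>\<^bsub>Heis\<^esub>) at_top sequentially \<and>
      (\<forall>x. (\<lambda>n. koranyi_dist (g n) x - koranyi_dist (g n) \<one>\<^bsub>Heis\<^esub>) \<longlonglongrightarrow> h x)}"

definition horoV :: "real ^ 'n \<Rightarrow> real ^ 'n \<Rightarrow> real \<Rightarrow> (real ^ 'n) \<times> (real ^ 'n)" where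
  "horoV a b c =
     - (((norm a)\<^sup>2 + (norm b)\<^sup>2) *\<^sub>R a - c *\<^sub>R b, ((norm a)\<^sup>2 + (norm b)\<^sup>2) *\<^sub>R b + c *\<^sub>R a)"

fun horofun :: "real ^ 'n \<Rightarrow> real ^ 'n \<Rightarrow> real \<Rightarrow> ('n::finite) heis \<Rightarrow> real" where
  "horofun a b c (v, u, t) = horoV a b c \<bullet> (rvec v, rvec u)"

definition busemann_border :: "('n::finite heis \<Rightarrow> real) set" where
  "busemann_border =
     {horofun a b c | a b c. ((norm a)\<^sup>2 + (norm b)\<^sup>2)\<^sup>2 + c\<^sup>2 = 1 \<and> c = 0}"

text \<open>The compact metric space is a compact subset \<open>X\<close> of a metric space type; the values of
  \<open>T g\<close> outside \<open>X\<close> are irrelevant. As the group is discrete, an action is continuous iff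
  each \<open>T g\<close> is.\<close>

locale heis_tds =
  fixes X :: "'x::metric_space set" and T :: "('n::finite) heis \<Rightarrow> 'x \<Rightarrow> 'x"
  assumes compact_space: "compact X"
    and maps_to: "\<And>g. T g \<in> X \<rightarrow> X"
    and continuous: "\<And>g. continuous_on X (T g)"
    and action_one: "\<And>x. x \<in> X \<Longrightarrow> T \<one>\<^bsub>Heis\<^esub> x = x"
    and action_mult: "\<And>g g' x. x \<in> X \<Longrightarrow> T g (T g' x) = T (g \<otimes>\<^bsub>Heis\<^esub> g') x"

definition factor_map ::
  "'x::metric_space set \<Rightarrow> (('n::finite) heis \<Rightarrow> 'x \<Rightarrow> 'x) \<Rightarrow>
   'y::metric_space set \<Rightarrow> ('n heis \<Rightarrow> 'y \<Rightarrow> 'y) \<Rightarrow> ('x \<Rightarrow> 'y) \<Rightarrow> bool" where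
  "factor_map X T Y S \<pi> \<longleftrightarrow>
     continuous_on X \<pi> \<and> \<pi> ` X = Y \<and> (\<forall>g. \<forall>x\<in>X. \<pi> (T g x) = S g (\<pi> x))"

definition bounded_to_one :: "'x set \<Rightarrow> 'y set \<Rightarrow> ('x \<Rightarrow> 'y) \<Rightarrow> bool" where
  "bounded_to_one X Y \<pi> \<longleftrightarrow>
     (\<exists>M::nat. \<forall>y\<in>Y. finite {x\<in>X. \<pi> x = y} \<and> card {x\<in>X. \<pi> x = y} \<le> M)"

definition ND_eps ::
  "'x::metric_space set \<Rightarrow> (('n::finite) heis \<Rightarrow> 'x \<Rightarrow> 'x) \<Rightarrow> ('x \<Rightarrow> 'y) \<Rightarrow> real \<Rightarrow>
   ('n heis \<Rightarrow> real) set" where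
  "ND_eps X T \<pi> \<epsilon> = {h \<in> border. \<exists>x\<in>X. \<exists>y\<in>X. x \<noteq> y \<and> \<pi> x = \<pi> y \<and>
      (\<forall>g\<in>{g. h g < 0}. dist (T g x) (T g y) \<le> \<epsilon>)}"

definition ND ::
  "'x::metric_space set \<Rightarrow> (('n::finite) heis \<Rightarrow> 'x \<Rightarrow> 'x) \<Rightarrow> ('x \<Rightarrow> 'y) \<Rightarrow>
   ('n heis \<Rightarrow> real) set" where
  "ND X T \<pi> = (\<Inter>\<epsilon>\<in>{0<..}. ND_eps X T \<pi> \<epsilon>)"

end

theory Submission
  imports Defs
begin

text \<open>Write \<open>\<nu>\<close> for the unit vector of a Busemann horofunction \<open>g \<mapsto> - (\<nu> \<bullet> horiz g)\<close>. By compactness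
  the set of nondeterministic \<open>\<nu>\<close> is closed, so it is enough to find, for every \<open>\<epsilon>\<close> and every
  horizontal vector \<open>w \<noteq> 0\<close>, a nondeterministic \<open>\<nu>\<close> with \<open>\<nu> \<bullet> w \<le> 0\<close>. Suppose there is none. Then the set
  of group elements at which two given points of a fiber are \<open>\<epsilon>\<close>-close can be enlarged at every
  point that sees, on a bounded scale, a half-space with inner normal \<open>\<nu>\<close>, \<open>\<nu> \<bullet> w \<le> 0\<close>, in this set. If
  it contains a large finite tube, it contains a half-infinite tube in direction \<open>w\<close>; and a two-sided
  tube grows to the whole group. A large fiber contains, by the pigeonhole principle, a pair of
  points that is close on translates of the finite tube arbitrarily far in direction \<open>-w\<close>, so this
  pair is close everywhere, which makes every \<open>\<nu>\<close> nondeterministic.\<close>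

section \<open>Coordinates on the Heisenberg group\<close>

fun horiz :: "'n::finite heis \<Rightarrow> (real ^ 'n) \<times> (real ^ 'n)" where
  "horiz (v, u, t) = (rvec v, rvec u)"

fun height :: "'n::finite heis \<Rightarrow> real" where
  "height (v, u, t) = 2 * (rvec v \<bullet> rvec u) - 4 * real_of_int t"

definition rot :: "'a::real_inner \<times> 'a \<Rightarrow> 'a \<times> 'a" where
  "rot p = (- snd p, fst p)"

lemma rvec_simps [simp]: "rvec (v + w) = rvec v + rvec w" "rvec (- v) = - rvec v" "rvec 0 = 0"
  by (simp_all add: rvec_def vec_eq_iff)

lemma inner_rvec: "rvec v \<bullet> rvec u = real_of_int (idot v u)"
  by (simp add: rvec_def idot_def inner_vec_def)

lemma horiz_hmult [simp]: "horiz (hmult g h) = horiz g + horiz h"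
  by (cases g; cases h) simp

text \<open>In this coordinate the cocycle of the group law is twice the standard symplectic form,
  with \<open>rot\<close> as the complex structure.\<close>

lemma height_hmult: "height (hmult k g) = height k + height g + 2 * (rot (horiz g) \<bullet> horiz k)"
  by (cases g; cases k) (simp add: rot_def inner_rvec[symmetric] algebra_simps inner_commute)

lemma rot_simps [simp]:
  "rot (p + q) = rot p + rot q" "rot (p - q) = rot p - rot q" "rot (r *\<^sub>R p) = r *\<^sub>R rot p"
  "rot (- p) = - rot p" "rot (rot p) = - p" "rot 0 = 0"
  by (simp_all add: rot_def prod_eq_iff)

lemma inner_rot_rot [simp]: "rot p \<bullet> rot q = p \<bullet> q"
  by (simp add: rot_def inner_prod_def)

lemma inner_rot_left: "rot p \<bullet> q = - (p \<bullet> rot q)"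
  by (simp add: rot_def inner_prod_def inner_commute)

lemma inner_rot_self [simp]: "rot p \<bullet> p = 0" "p \<bullet> rot p = 0"
  by (simp_all add: rot_def inner_prod_def inner_commute)

lemma norm_rot [simp]: "norm (rot p) = norm p"
  by (simp add: norm_eq_sqrt_inner)

section \<open>Filled subsets\<close>

definition "window D = {k :: 'n::finite heis. norm (horiz k) \<le> D \<and> \<bar>height k\<bar> \<le> D}"

text \<open>If no direction \<open>\<nu>\<close> with \<open>\<nu> \<bullet> e \<le> 0\<close> is nondeterministic, then, by compactness, closeness of two
  points of a fiber on a finite part of a half-space forces closeness at the identity. The set of
  group elements at which the two points are close is then \<open>filled\<close>.\<close>

definition filled ::
  "(real ^ 'n) \<times> (real ^ 'n) \<Rightarrow> real \<Rightarrow> real \<Rightarrow> ('n::finite) heis set \<Rightarrow> bool" where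
  "filled e \<eta> D G \<longleftrightarrow> (\<forall>g \<nu>. norm \<nu> = 1 \<and> \<nu> \<bullet> e \<le> \<eta> \<and>
     (\<forall>k\<in>window D. \<eta> < \<nu> \<bullet> horiz k \<longrightarrow> hmult k g \<in> G) \<longrightarrow> g \<in> G)"

text \<open>The conditions on the normal are homogeneous, so gradients can be used without
  normalising them.\<close>

lemma filledD:
  assumes "filled e \<eta> D G" and "v \<noteq> 0" and "v \<bullet> e \<le> \<eta> * norm v"
    and "\<And>k. k \<in> window D \<Longrightarrow> \<eta> * norm v < v \<bullet> horiz k \<Longrightarrow> hmult k g \<in> G"
  shows "g \<in> G"
proof -
  define \<nu> where "\<nu> = v /\<^sub>R norm v"
  have "norm \<nu> = 1" using assms(2) by (simp add: \<nu>_def)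
  moreover have "\<nu> \<bullet> e \<le> \<eta>" using assms(2,3) by (simp add: \<nu>_def field_simps)
  moreover have "hmult k g \<in> G" if "k \<in> window D" "\<eta> < \<nu> \<bullet> horiz k" for k
    using that assms(2) by (intro assms(4)) (simp_all add: \<nu>_def field_simps)
  ultimately show ?thesis using assms(1) unfolding filled_def by blast
qed

lemma hmult_assoc: "hmult (hmult a b) c = hmult a (hmult b c)"
  by (cases a; cases b; cases c) simp

text \<open>\<open>filled\<close> tests left multiples \<open>hmult k g\<close>, and these commute
  with right translations.\<close>

lemma filled_translate:
  assumes "filled e \<eta> D G" shows "filled e \<eta> D {g. hmult g q \<in> G}"
  using assms unfolding filled_def mem_Collect_eq hmult_assoc by blast

section \<open>Coordinates along \<open>e\<close> and the descent property of the lens\<close>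

locale filling =
  fixes e :: "(real ^ 'n::finite) \<times> (real ^ 'n)" and \<eta> D :: real
  assumes e: "norm e = 1" and \<eta>: "0 < \<eta>" "\<eta> \<le> 1" and D: "1 \<le> D"
begin

text \<open>Right multiplication by an element with horizontal part \<open>\<tau> e\<close> and height \<open>0\<close> shifts \<open>fwd\<close> by
  \<open>\<tau>\<close> and preserves \<open>side\<close>, \<open>perp\<close> and \<open>skew\<close>.\<close>

definition "fwd g = horiz g \<bullet> e"
definition "side g = horiz g \<bullet> rot e"
definition "perp g = horiz g - fwd g *\<^sub>R e"
definition "skew g = height g - 2 * side g * fwd g"

text \<open>The sublevel sets of \<open>lens\<close> are intersections of two solid paraboloids. Their apexes are
  displaced by \<open>c0\<close> off the axis \<open>perp = 0\<close>, as a boundary point with \<open>perp = 0\<close> and a central normal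
  could not be reached from a half-space with horizontal normal. The gradient of each paraboloid thus
  has norm at least \<open>2 * c0\<close>, and its component along \<open>e\<close> is relatively small or has the allowed
  sign.\<close>

definition "C = 32 * D / \<eta>"
text \<open>A bound for the second-order remainder of \<open>par\<close> over the window.\<close>

definition "c1 = D + 2 * D\<^sup>2 + C * D\<^sup>2"
text \<open>The first summand lets the gradients outweigh \<open>c1\<close>; the second makes the
  front steep enough in \<open>wall\<close>.\<close>

definition "c0 = 4 * c1 / \<eta> + 4096 * D ^ 3 * C / \<eta>\<^sup>2"

definition "par s g = s * skew g + C * (norm (perp g))\<^sup>2 + 2 * s * C * c0 * side g"
definition "lens g = max (par 1 g) (par (-1) g)"
text \<open>Minus the horizontal gradient of \<open>par s\<close> with respect to left
  multiplication: it points towards smaller values.\<close>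

definition "grad s g = - (2 * C) *\<^sub>R (perp g + (s * c0) *\<^sub>R rot e)
  - s *\<^sub>R (2 *\<^sub>R rot (perp g) - (2 * side g) *\<^sub>R e)"

lemma e_inner [simp]: "e \<bullet> e = 1" 
  using e by (simp add: norm_eq_1)

lemma rot_e_inner [simp]: "rot e \<bullet> e = 0" "e \<bullet> rot e = 0" "rot e \<bullet> rot e = 1"
  by simp_all

lemma perp_e [simp]: "perp g \<bullet> e = 0" "e \<bullet> perp g = 0"
  by (simp_all add: perp_def fwd_def inner_diff inner_commute)

lemma perp_rot_e: "perp g \<bullet> rot e = side g" 
  by (simp add: perp_def side_def inner_diff)

lemma rot_perp_e: "rot (perp g) \<bullet> e = - side g"
  by (simp add: inner_rot_left perp_rot_e)

lemma fwd_hmult: "fwd (hmult k g) = fwd g + fwd k"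
  and side_hmult: "side (hmult k g) = side g + side k"
  and perp_hmult: "perp (hmult k g) = perp g + perp k"
  by (simp_all add: fwd_def side_def perp_def inner_add algebra_simps)

text \<open>The correction \<open>2 * side g * fwd g\<close> in \<open>skew\<close> removes
  \<open>fwd g\<close> from the linear coefficient, so increments look the same all along the
  tube.\<close>

lemma skew_hmult:
  "skew (hmult k g) = skew g + skew k + (2 *\<^sub>R rot (perp g) - (2 * side g) *\<^sub>R e) \<bullet> horiz k"
proof -
  have "rot (perp g) \<bullet> horiz k = rot (horiz g) \<bullet> horiz k - fwd g * side k"
    by (simp add: perp_def inner_diff side_def inner_commute)
  then show ?thesis
    by (simp add: skew_def height_hmult fwd_hmult side_hmult inner_diff algebra_simps)
      (simp add: fwd_def inner_commute)
qed

lemma C_ge: "C \<ge> 32 * D" "C \<ge> 32" "C > 0" "\<eta> * C = 32 * D"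
  using \<eta> D by (auto simp: C_def field_simps intro: mult_left_le order_trans mult_mono)

lemma c1_ge: "c1 \<ge> 1" 
proof -
  have "0 \<le> 2 * D\<^sup>2 + C * D\<^sup>2" using C_ge by simp
  then show ?thesis using D unfolding c1_def by linarith
qed

lemma c0_ge: "c0 * \<eta> \<ge> 4 * c1" "c0 * \<eta>\<^sup>2 \<ge> 4096 * D ^ 3 * C" "c0 \<ge> 1" 
proof -
  have p: "0 \<le> 4096 * D ^ 3 * C / \<eta>\<^sup>2" "0 \<le> 4096 * D ^ 3 * C * \<eta> / \<eta>\<^sup>2" "0 \<le> 4 * c1 * \<eta>\<^sup>2 / \<eta>" "0 \<le> 4 * c1 / \<eta>"
    using \<eta> D C_ge c1_ge by simp_all
  show *: "c0 * \<eta> \<ge> 4 * c1" using p \<eta> unfolding c0_def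
    by (simp add: distrib_right)
  show "c0 * \<eta>\<^sup>2 \<ge> 4096 * D ^ 3 * C" using p \<eta> unfolding c0_def by (simp add: distrib_right)
  have "1 \<le> c0 * \<eta>" using * c1_ge by simp
  also have "\<dots> \<le> c0" using \<eta> p unfolding c0_def by (intro mult_left_le) auto
  finally show "c0 \<ge> 1" .
qed

lemma norm_perp_le: "norm (perp g) \<le> norm (horiz g)"
proof -
  have "(norm (perp g))\<^sup>2 = (norm (horiz g))\<^sup>2 - (fwd g)\<^sup>2"
    by (simp add: power2_norm_eq_inner) (simp add: perp_def fwd_def inner_diff inner_commute power2_eq_square)
  then have "(norm (perp g))\<^sup>2 \<le> (norm (horiz g))\<^sup>2" by simp
  then show ?thesis by (rule power2_le_imp_le) simp
qed

lemma side_le: "\<bar>side g\<bar> \<le> norm (perp g)"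
  using Cauchy_Schwarz_ineq2[of "perp g" "rot e"] e by (simp add: perp_rot_e)

lemma fwd_le: "\<bar>fwd g\<bar> \<le> norm (horiz g)"
  using Cauchy_Schwarz_ineq2[of "horiz g" e] e by (simp add: fwd_def)

lemma skew_window: assumes "k \<in> window D" shows "\<bar>skew k\<bar> \<le> D + 2 * D\<^sup>2"
proof -
  have "\<bar>side k * fwd k\<bar> \<le> D * D"
    unfolding abs_mult using assms side_le[of k] norm_perp_le[of k] fwd_le[of k]
    by (intro mult_mono) (auto simp: window_def)
  then show ?thesis using assms by (auto simp: skew_def window_def power2_eq_square)
qed

text \<open>As \<open>par s\<close> is quadratic, the remainder of its first-order expansion depends
  on \<open>k\<close> alone.\<close>

lemma par_hmult:
  assumes "k \<in> window D" "s = 1 \<or> s = -1"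
  shows "\<bar>par s (hmult k g) - par s g + grad s g \<bullet> horiz k\<bar> \<le> c1"
proof -
  have "perp g \<bullet> horiz k = perp g \<bullet> perp k"
    by (simp add: perp_def[of k] inner_diff)
  then have "par s (hmult k g) - par s g + grad s g \<bullet> horiz k = s * skew k + C * (norm (perp k))\<^sup>2"
    by (simp add: par_def skew_hmult side_hmult perp_hmult grad_def inner_diff inner_add 
       power2_norm_eq_inner side_def inner_commute algebra_simps)
  moreover have "\<bar>s * skew k\<bar> \<le> D + 2 * D\<^sup>2" using skew_window[OF assms(1)] assms(2) by auto
  moreover have "C * (norm (perp k))\<^sup>2 \<le> C * D\<^sup>2"
    using norm_perp_le[of k] assms(1) C_ge by (auto simp: window_def intro!: power_mono mult_left_mono)
  moreover have "0 \<le> C * (norm (perp k))\<^sup>2" using C_ge by simp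
  ultimately show ?thesis unfolding c1_def by linarith
qed

text \<open>The components along \<open>e\<close> and \<open>rot e\<close> are
  \<open>4 * s * side g\<close> and \<open>- 2 * C * (side g + s * c0)\<close>; the offset
  \<open>c0\<close> keeps them from being small together. If the first is positive, the second is at
  least \<open>C / 2\<close> times as large in absolute value, whence the third bound. The fourth
  measures the deviation from a radial vector.\<close>

lemma grad_bounds:
  assumes "s = 1 \<or> s = -1"
  shows "2 * c0 \<le> norm (grad s g)" "norm (grad s g) \<le> 4 * C * (norm (perp g) + c0)"
    "grad s g \<bullet> e \<le> 2 / C * norm (grad s g)"
    "norm (grad s g + (2 * C) *\<^sub>R perp g) \<le> 2 * C * c0 + 4 * norm (perp g)"
proof -
  have e1: "grad s g \<bullet> e = 4 * s * side g"
    by (simp add: grad_def inner_diff inner_add rot_perp_e algebra_simps)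
  have e2: "grad s g \<bullet> rot e = - 2 * C * (side g + s * c0)"
    by (simp add: grad_def inner_diff inner_add perp_rot_e algebra_simps)
  have n1: "4 * \<bar>side g\<bar> \<le> norm (grad s g)"
    using Cauchy_Schwarz_ineq2[of "grad s g" e] e assms by (auto simp: e1)
  have n2: "2 * C * \<bar>side g + s * c0\<bar> \<le> norm (grad s g)"
    using Cauchy_Schwarz_ineq2[of "grad s g" "rot e"] e C_ge by (simp add: e2 abs_mult)
  have n3: "4 * \<bar>side g + s * c0\<bar> \<le> 2 * C * \<bar>side g + s * c0\<bar>"
    using C_ge by (intro mult_right_mono) auto
  have "c0 \<le> \<bar>side g\<bar> + \<bar>side g + s * c0\<bar>" using assms c0_ge by auto
  then have "4 * c0 \<le> 4 * \<bar>side g\<bar> + 4 * \<bar>side g + s * c0\<bar>" by simp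
  also have "\<dots> \<le> norm (grad s g) + norm (grad s g)"
    by (intro add_mono n1 order_trans[OF n3 n2])
  finally show "2 * c0 \<le> norm (grad s g)" by simp
  show "grad s g \<bullet> e \<le> 2 / C * norm (grad s g)"
  proof (cases "s * side g \<le> 0")
    case True
    have "0 \<le> 2 / C * norm (grad s g)" using C_ge by simp
    with True show ?thesis unfolding e1 by linarith
  next
    case False
    then have "\<bar>side g + s * c0\<bar> \<ge> s * side g" using assms c0_ge by auto
    then have "2 * C * (s * side g) \<le> norm (grad s g)" 
      using n2 C_ge by (smt (verit) mult_left_mono)
    then show ?thesis unfolding e1 using C_ge by (simp add: field_simps)
  qed
  have "grad s g + (2 * C) *\<^sub>R perp g = - (2 * C * s * c0) *\<^sub>R rot e - s *\<^sub>R (2 *\<^sub>R rot (perp g) - (2 * side g) *\<^sub>R e)"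
    by (simp add: grad_def algebra_simps)
  also have "norm \<dots> \<le> norm ((2 * C * s * c0) *\<^sub>R rot e) + norm (s *\<^sub>R (2 *\<^sub>R rot (perp g) - (2 * side g) *\<^sub>R e))"
    by (rule order_trans[OF norm_triangle_ineq4]) simp
  also have "norm ((2 * C * s * c0) *\<^sub>R rot e) = 2 * C * c0"
    using assms C_ge c0_ge by (auto simp: e abs_mult)
  also have "norm (s *\<^sub>R (2 *\<^sub>R rot (perp g) - (2 * side g) *\<^sub>R e)) \<le> 2 * norm (perp g) + 2 * \<bar>side g\<bar>"
    using assms norm_triangle_ineq4[of "2 *\<^sub>R rot (perp g)" "(2 * side g) *\<^sub>R e"] by (auto simp: e)
  finally show n4: "norm (grad s g + (2 * C) *\<^sub>R perp g) \<le> 2 * C * c0 + 4 * norm (perp g)"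
    using side_le[of g] by simp
  have "norm (grad s g) \<le> norm (grad s g + (2 * C) *\<^sub>R perp g) + norm ((2 * C) *\<^sub>R perp g)"
    using norm_triangle_ineq4[of "grad s g + (2 * C) *\<^sub>R perp g" "(2 * C) *\<^sub>R perp g"] by simp
  also have "\<dots> \<le> 2 * C * c0 + 4 * norm (perp g) + 2 * C * norm (perp g)"
    using n4 C_ge by simp
  also have "4 * norm (perp g) \<le> 2 * C * norm (perp g)" using C_ge by (intro mult_right_mono) auto
  also have "2 * C * c0 + 2 * C * norm (perp g) + 2 * C * norm (perp g) \<le> 4 * C * (norm (perp g) + c0)"
    using C_ge c0_ge by (simp add: algebra_simps)
  finally show "norm (grad s g) \<le> 4 * C * (norm (perp g) + c0)" by simp
qed

lemma par_sum: "par 1 g + par (-1) g = 2 * (C * (norm (perp g))\<^sup>2)"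
  by (simp add: par_def)

text \<open>The maximum of the two paraboloids is at least their mean.\<close>

lemma norm_perp_lens: "C * (norm (perp g))\<^sup>2 \<le> lens g"
  using par_sum[of g] unfolding lens_def by linarith

lemma par_change:
  assumes "k \<in> window D" "s = 1 \<or> s = -1"
  shows "\<bar>par s (hmult k g) - par s g\<bar> \<le> c1 + 4 * C * D * (norm (perp g) + c0)"
proof -
  have "\<bar>grad s g \<bullet> horiz k\<bar> \<le> norm (grad s g) * norm (horiz k)" by (rule Cauchy_Schwarz_ineq2)
  also have "\<dots> \<le> 4 * C * (norm (perp g) + c0) * D"
    using grad_bounds(2)[OF assms(2)] assms(1) C_ge c0_ge
    by (intro mult_mono) (auto simp: window_def)
  finally show ?thesis using par_hmult[OF assms, of g] by (simp add: algebra_simps)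
qed

lemma lens_change:
  assumes "k \<in> window D"
  shows "\<bar>lens (hmult k g) - lens g\<bar> \<le> c1 + 4 * C * D * (norm (perp g) + c0)"
  using par_change[OF assms, of 1 g] par_change[OF assms, of "-1" g] unfolding lens_def by linarith

text \<open>Beyond the radius \<open>r0\<close> both gradients are nearly radial. At levels above
  \<open>m0\<close>, points where the two paraboloids almost agree lie beyond this radius.\<close>

definition "r0 = 16 * D * c0 / \<eta>"
definition "m0 = C * r0\<^sup>2 + c1 + 4 * C * D * (r0 + c0) + 1"

text \<open>Near the rim, where both paraboloids matter, both gradients are almost radial, so the radial
  direction decreases both; elsewhere the gradient of the larger one decreases the maximum.\<close>

lemma lens_descent:
  assumes "m0 \<le> lens g"
  obtains u where "2 * c0 \<le> norm u" "norm u \<le> 4 * C * (norm (perp g) + c0)"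
    "u \<bullet> e \<le> 2 / C * norm u"
    "\<And>k. k \<in> window D \<Longrightarrow> lens (hmult k g) \<le> lens g - u \<bullet> horiz k + \<eta> / 4 * norm u"
proof -
  note result = that
  \<comment> \<open>\<open>S\<close> bounds the change of either paraboloid over a window, so a gap
    of \<open>2 * S\<close> preserves which of them is the larger.\<close>
  define S where "S = c1 + 4 * C * D * (norm (perp g) + c0)"
  have far: thesis if s: "s = 1 \<or> s = -1" and gap: "par (- s) g + 2 * S \<le> par s g" for s
  proof (rule result[of "grad s g"])
    fix k :: "'n heis" assume k: "k \<in> window D"
    have s': "- s = 1 \<or> - s = -1" using s by auto
    have "par (- s) (hmult k g) \<le> par s (hmult k g)"
      using par_change[OF k s, of g, folded S_def] par_change[OF k s', of g, folded S_def] gap by arith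
    moreover have "par (- s) g \<le> par s g" 
      using gap c1_ge C_ge D c0_ge unfolding S_def by (smt (verit) mult_nonneg_nonneg norm_ge_zero)
    ultimately have l: "lens (hmult k g) = par s (hmult k g)" "lens g = par s g" 
      using s by (auto simp: lens_def)
    have "c1 \<le> c0 * \<eta> / 4" using c0_ge(1) by simp
    also have "\<dots> \<le> \<eta> / 4 * norm (grad s g)" 
      using mult_right_mono[OF grad_bounds(1)[OF s, of g], of "\<eta> / 4"] \<eta> c0_ge by simp
    finally show "lens (hmult k g) \<le> lens g - grad s g \<bullet> horiz k + \<eta> / 4 * norm (grad s g)"
      using par_hmult[OF k s, of g] l by linarith
  qed (use grad_bounds[OF s] in auto)
  show thesis
  proof (cases "\<bar>par 1 g - par (-1) g\<bar> \<ge> 2 * S")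
    case True
    then have "par (-1) g + 2 * S \<le> par 1 g \<or> par 1 g + 2 * S \<le> par (-1) g" by linarith
    then show thesis using far[of 1] far[of "-1"] by auto
  next
    case False
    \<comment> \<open>Twice a maximum is the sum plus the absolute difference.\<close>
    have "2 * lens g \<le> 2 * (C * (norm (perp g))\<^sup>2) + 2 * S"
      using False par_sum[of g] unfolding lens_def by linarith
    then have *: "m0 \<le> C * (norm (perp g))\<^sup>2 + S" using assms by simp
    have r: "r0 \<le> norm (perp g)"
    proof (rule ccontr)
      assume "\<not> r0 \<le> norm (perp g)"
      then have "C * (norm (perp g))\<^sup>2 \<le> C * r0\<^sup>2" "4 * C * D * (norm (perp g) + c0) \<le> 4 * C * D * (r0 + c0)"
        using C_ge D by (auto intro!: mult_left_mono power_mono)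
      then show False using * unfolding m0_def S_def by linarith
    qed
    have "c0 \<le> r0" using \<eta> D c0_ge
      unfolding r0_def by (simp add: field_simps)
    \<comment> \<open>The radial part common to both gradients; it is orthogonal to
      \<open>e\<close>.\<close>
    define u where "u = - (2 * C) *\<^sub>R perp g"
    have nu: "norm u = 2 * C * norm (perp g)" using C_ge by (simp add: u_def)
    have "1 * c0 \<le> C * norm (perp g)"
      using r \<open>c0 \<le> r0\<close> C_ge(2) c0_ge(3) by (intro mult_mono) auto
    then have u0: "2 * c0 \<le> norm u" unfolding nu by simp
    show thesis
    proof (rule result[of u])
      show "2 * c0 \<le> norm u" by (rule u0)
      show "norm u \<le> 4 * C * (norm (perp g) + c0)" using C_ge c0_ge by (simp add: nu algebra_simps)
      show "u \<bullet> e \<le> 2 / C * norm u" using C_ge by (simp add: u_def)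
    next
      fix k :: "'n heis" assume k: "k \<in> window D"
      have "par s (hmult k g) \<le> lens g - u \<bullet> horiz k + \<eta> / 4 * norm u" if s: "s = 1 \<or> s = -1" for s
      proof -
        \<comment> \<open>The allowance \<open>\<eta> / 4 * norm u\<close> is split evenly: one half
          pays for replacing the gradient by \<open>u\<close>, the other for the remainder
          \<open>c1\<close>.\<close>
        have d: "2 * C * c0 + 4 * norm (perp g) \<le> (\<eta> / 8) * norm u / D"
        proof -
          have "4 * norm (perp g) \<le> \<eta> / 8 * (C * norm (perp g)) / D"

          proof -
            have "\<eta> / 8 * (C * norm (perp g)) / D = (\<eta> * C) * norm (perp g) / (8 * D)" by simp
            also have "\<dots> = 4 * norm (perp g)" unfolding C_ge(4) using D by simp
            finally show ?thesis by simp
          qed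
          moreover have "2 * C * c0 \<le> \<eta> / 8 * (C * norm (perp g)) / D"
          proof -
            have "16 * D * c0 \<le> \<eta> * norm (perp g)"
              using r \<eta> by (simp add: r0_def field_simps)
            then have "C * (16 * D * c0) \<le> C * (\<eta> * norm (perp g))" using C_ge by (intro mult_left_mono) auto
            then have "C * (16 * D * c0) / (8 * D) \<le> C * (\<eta> * norm (perp g)) / (8 * D)"
              using D by (intro divide_right_mono) auto
            then show ?thesis using D by (simp add: mult_ac)
          qed
          moreover have "\<eta> / 8 * (2 * C * norm (perp g)) / D =
              \<eta> / 8 * (C * norm (perp g)) / D + \<eta> / 8 * (C * norm (perp g)) / D" by simp
          ultimately show ?thesis unfolding nu by linarith
        qed
        have "\<bar>(grad s g - u) \<bullet> horiz k\<bar> \<le> norm (grad s g - u) * norm (horiz k)" by (rule Cauchy_Schwarz_ineq2)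
        also have "\<dots> \<le> (2 * C * c0 + 4 * norm (perp g)) * D"
          using grad_bounds(4)[OF s, of g] k C_ge c0_ge
          by (intro mult_mono) (auto simp: window_def u_def)
        also have "\<dots> \<le> \<eta> / 8 * norm u" using mult_right_mono[OF d, of D] D by simp
        finally have "- (grad s g \<bullet> horiz k) \<le> - (u \<bullet> horiz k) + \<eta> / 8 * norm u"
          unfolding inner_diff_left by linarith
        moreover have "c1 \<le> \<eta> / 8 * norm u"
        proof -
          have "c1 \<le> \<eta> / 8 * (2 * c0)" using c0_ge(1) by (simp add: mult.commute)
          also have "\<dots> \<le> \<eta> / 8 * norm u" using u0 \<eta> by (intro mult_left_mono) auto
          finally show ?thesis .
        qed
        moreover have "par s g \<le> lens g" using s by (auto simp: lens_def)
        ultimately show ?thesis using par_hmult[OF k s, of g] by linarith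
      qed
      from this[of 1] this[of "-1"] show "lens (hmult k g) \<le> lens g - u \<bullet> horiz k + \<eta> / 4 * norm u"
        by (simp add: lens_def)
    qed
  qed
qed

section \<open>Prolonging a tube and growing it to the whole group\<close>

text \<open>A finite tube is prolonged in the direction \<open>e\<close> by moving a front on which \<open>fwd + delay (lens g)\<close>
  is constant. The constants make the front so steep near \<open>lens g = M\<close> that filling there does not
  leave the tube, while its curvature \<open>b\<close> stays negligible on the scale of the window.\<close>

definition "m1 = m0 + c1 + 4 * C * D * (sqrt (m0 / C) + c0)"
definition "M = 4 * m1 + C * c0\<^sup>2 + 4096 * D\<^sup>2 * C"
text \<open>By this choice the quadratic term of \<open>delay_step\<close> costs at most
  \<open>\<eta> / 4\<close> over a window.\<close>

definition "b = \<eta> / (8 * D\<^sup>2 * (64 * C * M))"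
text \<open>Zero up to \<open>m1\<close>, a level that a window step from below \<open>m0\<close>
  does not exceed; quadratic beyond it.\<close>

definition "delay m = b / 2 * (max 0 (m - m1))\<^sup>2"
text \<open>Points of the tube at which the front has yet to arrive have
  \<open>D \<le> fwd g\<close>, so a window step from them keeps \<open>fwd\<close>
  nonnegative.\<close>

definition "H0 = delay M + D"
definition "base = {g. 0 \<le> fwd g \<and> fwd g \<le> H0 \<and> lens g < M}"
definition "front H = {g. 0 \<le> fwd g \<and> lens g < M \<and> fwd g + delay (lens g) < H}"

lemma m0_ge: "m0 \<ge> 1"
proof -
  have "0 \<le> C * r0\<^sup>2" "0 \<le> 4 * C * D * (r0 + c0)"
    using C_ge D c0_ge \<eta> by (simp_all add: r0_def)
  then show ?thesis using c1_ge unfolding m0_def by linarith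
qed

lemma m1_ge: "m1 \<ge> m0" "m1 \<ge> 1"
proof -
  have "0 \<le> 4 * C * D * (sqrt (m0 / C) + c0)"
    using C_ge D c0_ge m0_ge by simp
  then show "m1 \<ge> m0" "m1 \<ge> 1" using c1_ge m0_ge unfolding m1_def by linarith+
qed

lemma M_ge: "M \<ge> 4 * m1" "M \<ge> C * c0\<^sup>2" "M \<ge> 4096 * D\<^sup>2 * C" "M > m1" "M > 0"
proof -
  have "0 \<le> C * c0\<^sup>2" "0 \<le> 4096 * D\<^sup>2 * C" using C_ge by simp_all
  then show "M \<ge> 4 * m1" "M \<ge> C * c0\<^sup>2" "M \<ge> 4096 * D\<^sup>2 * C" "M > m1" "M > 0"
    using m1_ge unfolding M_def by linarith+
qed

lemma b_pos: "b > 0" and b_eq: "b * (512 * D\<^sup>2 * C * M) = \<eta>"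
  using \<eta> D C_ge M_ge by (simp_all add: b_def)

lemma delay_nonneg: "0 \<le> delay m" using b_pos by (simp add: delay_def)

lemma delay_mono: "m \<le> m' \<Longrightarrow> delay m \<le> delay m'"
  using b_pos by (auto simp: delay_def intro!: mult_left_mono power_mono)

text \<open>A second-order Taylor bound: the derivative \<open>b * max 0 (m - m1)\<close> is
  Lipschitz with constant \<open>b\<close>.\<close>

lemma delay_step: "delay (m + d) \<le> delay m + b * max 0 (m - m1) * d + b / 2 * d\<^sup>2"
proof -
  have "(max 0 (m + d - m1))\<^sup>2 \<le> (max 0 (m - m1))\<^sup>2 + 2 * max 0 (m - m1) * d + d\<^sup>2"
  proof (cases "m - m1 \<ge> 0")
    case True
    then have "(max 0 (m + d - m1))\<^sup>2 \<le> ((m - m1) + d)\<^sup>2"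
      by (auto simp: max_def algebra_simps)
    also have "\<dots> = (m - m1)\<^sup>2 + 2 * (m - m1) * d + d\<^sup>2" by (simp add: power2_sum)
    finally show ?thesis using True by simp
  next
    case False
    then have "max 0 (m + d - m1) \<le> \<bar>d\<bar>" by auto
    then have "(max 0 (m + d - m1))\<^sup>2 \<le> \<bar>d\<bar>\<^sup>2" by (intro power_mono) auto
    then show ?thesis using False by simp
  qed
  then have "b / 2 * (max 0 (m + d - m1))\<^sup>2 \<le> b / 2 * ((max 0 (m - m1))\<^sup>2 + 2 * max 0 (m - m1) * d + d\<^sup>2)"
    using b_pos by (intro mult_left_mono) auto
  then show ?thesis by (simp add: delay_def algebra_simps)
qed

lemma grad_bound_M:
  assumes "lens g < M" "r \<le> 4 * C * (norm (perp g) + c0)" "0 \<le> r"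
  shows "r\<^sup>2 \<le> 64 * C * M"
proof -
  have "r\<^sup>2 \<le> (4 * C * (norm (perp g) + c0))\<^sup>2" using assms by (intro power_mono) auto
  also have "\<dots> = 16 * C\<^sup>2 * (norm (perp g) + c0)\<^sup>2" by (simp add: power_mult_distrib)
  also have "\<dots> \<le> 16 * C\<^sup>2 * (2 * ((norm (perp g))\<^sup>2 + c0\<^sup>2))"
    using sum_squares_bound[of "norm (perp g)" c0]
    by (intro mult_left_mono) (auto simp: power2_sum)
  also have "\<dots> = 32 * C * (C * (norm (perp g))\<^sup>2 + C * c0\<^sup>2)"
    by (simp add: algebra_simps power2_eq_square)
  also have "\<dots> \<le> 32 * C * (M + M)"
    using norm_perp_lens[of g] assms(1) M_ge C_ge by (intro mult_left_mono add_mono) auto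
  finally show ?thesis by simp
qed

text \<open>Since \<open>u\<close> has at most a small positive component along \<open>e\<close>,
  the two summands hardly cancel. With \<open>t = a * norm u\<close> the estimate reduces to
  \<open>(t - 1)\<close> squared being nonnegative.\<close>

lemma norm_tilt:
  assumes "0 \<le> a" "u \<bullet> e \<le> 2 / C * norm u"
  shows "(a * norm u + 1) / 2 \<le> norm (a *\<^sub>R u - e)"
proof -
  have "u \<bullet> e \<le> 2 / C * norm u" by fact
  also have "2 / C * norm u \<le> 1 / 2 * norm u"
    using C_ge by (intro mult_right_mono) (auto simp: field_simps)
  finally have "a * (u \<bullet> e) \<le> a * (1 / 2 * norm u)" using assms(1) by (rule mult_left_mono)
  then have "(a * norm u)\<^sup>2 + 1 - a * norm u \<le> (norm (a *\<^sub>R u - e))\<^sup>2"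
    by (simp add: power2_norm_eq_inner inner_diff inner_commute power_mult_distrib)
      (simp add: power2_eq_square)
  moreover have "((a * norm u + 1) / 2)\<^sup>2 \<le> (a * norm u)\<^sup>2 + 1 - a * norm u"
    using zero_le_power2[of "a * norm u - 1"] by (simp add: power2_eq_square field_simps)
  ultimately show ?thesis by (intro power2_le_imp_le[OF _ norm_ge_zero]) linarith
qed

text \<open>Below level \<open>M / 2\<close> a window step cannot raise the lens by more than
  \<open>M / 2\<close>. Above it the slope \<open>a\<close> is so large that
  \<open>a *\<^sub>R u\<close> dominates \<open>e\<close> in the normal, and the lens does not
  increase.\<close>

lemma wall:
  assumes "lens g < M" "m0 \<le> lens g" "k \<in> window D"
    and u: "2 * c0 \<le> norm u" "(norm u)\<^sup>2 \<le> 64 * C * M" "u \<bullet> e \<le> 2 / C * norm u"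
    and l: "lens (hmult k g) \<le> lens g - u \<bullet> horiz k + \<eta> / 4 * norm u"
    and a: "a = b * max 0 (lens g - m1)"
    and v: "\<eta> * norm (a *\<^sub>R u - e) < (a *\<^sub>R u - e) \<bullet> horiz k"
  shows "lens (hmult k g) < M"
proof (cases "lens g < M / 2")
  case True
  have "- (u \<bullet> horiz k) + \<eta> / 4 * norm u \<le> M / 2"
  proof -
    have "\<bar>u \<bullet> horiz k\<bar> \<le> norm u * norm (horiz k)" by (rule Cauchy_Schwarz_ineq2)
    also have "\<dots> \<le> norm u * D" using assms(3) by (intro mult_left_mono) (auto simp: window_def)
    finally have 1: "\<bar>u \<bullet> horiz k\<bar> \<le> norm u * D" .
    have "\<eta> / 4 * norm u \<le> D * norm u" using \<eta> D by (intro mult_right_mono) auto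
    moreover have "2 * D * norm u \<le> M / 2"
    proof (rule power2_le_imp_le)
      have "(2 * D * norm u)\<^sup>2 \<le> 4 * D\<^sup>2 * (64 * C * M)"
        unfolding power_mult_distrib using u(2) by (intro mult_mono) auto
      also have "\<dots> = (256 * D\<^sup>2 * C) * M" by simp
      also have "\<dots> \<le> (M / 4) * M"

      proof (rule mult_right_mono)
        have "0 \<le> D\<^sup>2 * C" using C_ge by simp
        then show "256 * D\<^sup>2 * C \<le> M / 4" using M_ge(3) by linarith
      qed (use M_ge in simp)
      finally show "(2 * D * norm u)\<^sup>2 \<le> (M / 2)\<^sup>2" by (simp add: power2_eq_square)
    qed (use M_ge in simp)
    ultimately show ?thesis using 1 by (simp add: mult.commute)
  qed
  then show ?thesis using l True by linarith
next
  case False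
  then have "M / 4 \<le> lens g - m1" using M_ge by linarith
  then have "b * (M / 4) \<le> a" unfolding a using b_pos by (intro mult_left_mono max.coboundedI2) auto
  then have a1: "b * M / 4 \<le> a" by simp
  have bM: "b * M * (512 * D\<^sup>2 * C) = \<eta>" using b_eq by (simp add: mult_ac)
  have apos: "0 < a" using a1 b_pos M_ge by (smt (verit) divide_pos_pos mult_pos_pos)
  \<comment> \<open>This is where the second summand of \<open>c0\<close> enters: a drift of at most
    \<open>D\<close> along \<open>e\<close> uses up at most a quarter of
    \<open>a * (\<eta> * norm u)\<close>.\<close>
  have "4 * D \<le> a * (\<eta> * norm u)"
  proof -
    have "4 * D * (512 * D\<^sup>2 * C) \<le> \<eta> * (\<eta> * c0) / 2"
      using c0_ge(2) by (simp add: power2_eq_square power3_eq_cube mult_ac)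
    also have "\<dots> = b * M * (512 * D\<^sup>2 * C) * (\<eta> * c0) / 2" using bM by simp
    finally have "4 * D * (512 * D\<^sup>2 * C) \<le> (b * M * (\<eta> * c0) / 2) * (512 * D\<^sup>2 * C)" by (simp add: mult_ac)
    then have "4 * D \<le> b * M * (\<eta> * c0) / 2"
      by (rule mult_right_le_imp_le) (use D C_ge in simp)
    also have "\<dots> = (b * M / 4) * (\<eta> * (2 * c0))" by simp
    also have "\<dots> \<le> a * (\<eta> * norm u)"
      using a1 u(1) \<eta> apos c0_ge by (intro mult_mono mult_left_mono) auto
    finally show ?thesis .
  qed
  moreover have "\<eta> * ((a * norm u + 1) / 2) < a * (u \<bullet> horiz k) + D"
  proof -
    have "\<eta> * ((a * norm u + 1) / 2) \<le> \<eta> * norm (a *\<^sub>R u - e)"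
      using norm_tilt[OF less_imp_le[OF apos] u(3)] \<eta> by (intro mult_left_mono) auto
    also have "\<dots> < (a *\<^sub>R u - e) \<bullet> horiz k" by (rule v)
    also have "\<dots> = a * (u \<bullet> horiz k) - fwd k" by (simp add: inner_diff fwd_def inner_commute)
    also have "\<dots> \<le> a * (u \<bullet> horiz k) + D"
      using fwd_le[of k] assms(3) by (auto simp: window_def)
    finally show ?thesis .
  qed
  ultimately have "a * (- (u \<bullet> horiz k) + \<eta> / 4 * norm u) \<le> 0"
    using \<eta> by (simp add: algebra_simps)
  then have "- (u \<bullet> horiz k) + \<eta> / 4 * norm u \<le> 0" using apos by (simp add: mult_le_0_iff)
  then show ?thesis using l assms(1) by linarith
qed

text \<open>The normal \<open>a *\<^sub>R u - e\<close> plays the role of minus the gradient of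
  \<open>fwd + delay (lens g)\<close>. A window step along it lowers this function by
  \<open>\<eta> / 2\<close> to first order and loses at most \<open>\<eta> / 4\<close> to curvature.
  In the core \<open>lens g < m0\<close> the delay vanishes and \<open>- e\<close> serves as
  normal.\<close>

lemma front_step:
  assumes G: "filled e \<eta> D G" and H: "H0 \<le> H" "front H \<subseteq> G"
  shows "front (H + \<eta> / 4) \<subseteq> G"
proof
  fix g assume g: "g \<in> front (H + \<eta> / 4)"
  show "g \<in> G"
  proof (cases "fwd g + delay (lens g) < H")
    case True
    then show ?thesis using g H(2) by (auto simp: front_def)
  next
    case False
    have lg: "lens g < M" using g by (simp add: front_def)
    have "D \<le> fwd g" using False H(1) delay_mono[of "lens g" M] lg unfolding H0_def by linarith
    then have fwd_nonneg: "0 \<le> fwd (hmult k g)" if "k \<in> window D" for k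
      using fwd_le[of k] that by (auto simp: window_def fwd_hmult)
    show ?thesis
    proof (cases "m0 \<le> lens g")
      case True
      obtain u where u: "2 * c0 \<le> norm u" "norm u \<le> 4 * C * (norm (perp g) + c0)"
        "u \<bullet> e \<le> 2 / C * norm u"
        and desc: "\<And>k. k \<in> window D \<Longrightarrow> lens (hmult k g) \<le> lens g - u \<bullet> horiz k + \<eta> / 4 * norm u"
        by (rule lens_descent[OF True]) blast
      have u2: "(norm u)\<^sup>2 \<le> 64 * C * M" using grad_bound_M[OF lg u(2)] by simp
      define a where "a = b * max 0 (lens g - m1)"
      have a0: "0 \<le> a" using b_pos by (simp add: a_def)
      define v where "v = a *\<^sub>R u - e"
      have nv: "(a * norm u + 1) / 2 \<le> norm v" using norm_tilt[OF a0 u(3)] by (simp add: v_def)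
      show ?thesis
      proof (rule filledD[OF G, of v])
        have "0 < norm v" using nv a0 by (smt (verit) divide_pos_pos mult_nonneg_nonneg norm_ge_zero)
        then show "v \<noteq> 0" by simp
        \<comment> \<open>The summand \<open>- e\<close> contributes \<open>- 1\<close>, which has
          the favourable sign and is dropped.\<close>
        have "v \<bullet> e \<le> a * (u \<bullet> e)" by (simp add: v_def inner_diff)
        also have "\<dots> \<le> a * (2 / C * norm u)" using u(3) a0 by (rule mult_left_mono)
        also have "\<dots> \<le> 4 / C * ((a * norm u + 1) / 2)" using C_ge by (simp add: field_simps)
        also have "\<dots> \<le> \<eta> * norm v"
        proof (rule mult_mono[OF _ nv])
          show "4 / C \<le> \<eta>" using C_ge D by (simp add: field_simps)
        qed (use \<eta> a0 in auto)
        finally show "v \<bullet> e \<le> \<eta> * norm v" .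
      next
        fix k :: "'n heis" assume k: "k \<in> window D" and kv: "\<eta> * norm v < v \<bullet> horiz k"
        define d where "d = - (u \<bullet> horiz k) + \<eta> / 4 * norm u"
        have ld: "lens (hmult k g) \<le> lens g + d" using desc[OF k] by (simp add: d_def)
        have "\<bar>d\<bar> \<le> 2 * D * norm u"
        proof -
          have "\<bar>u \<bullet> horiz k\<bar> \<le> norm u * norm (horiz k)" by (rule Cauchy_Schwarz_ineq2)
          also have "\<dots> \<le> norm u * D" using k by (intro mult_left_mono) (auto simp: window_def)
          finally have "\<bar>u \<bullet> horiz k\<bar> \<le> D * norm u" by (simp add: mult.commute)
          moreover have "\<bar>\<eta> / 4 * norm u\<bar> \<le> D * norm u"
            using \<eta> D unfolding abs_mult by (intro mult_mono) auto
          ultimately show ?thesis unfolding d_def by linarith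
        qed
        then have "\<bar>d\<bar>\<^sup>2 \<le> (2 * D * norm u)\<^sup>2" by (intro power_mono) auto
        also have "\<dots> \<le> 4 * D\<^sup>2 * (64 * C * M)"
          unfolding power_mult_distrib using u2 by (intro mult_mono) auto
        finally have "b / 2 * d\<^sup>2 \<le> b / 2 * (4 * D\<^sup>2 * (64 * C * M))"
          using b_pos by (intro mult_left_mono) auto
        also have "\<dots> = \<eta> / 4" using b_eq by (simp add: mult_ac)
        finally have bd: "b / 2 * d\<^sup>2 \<le> \<eta> / 4" .
        have "fwd k + a * d = - (v \<bullet> horiz k) + \<eta> / 4 * (a * norm u)"
          by (simp add: v_def d_def inner_diff fwd_def inner_commute algebra_simps)
        also have "\<dots> \<le> - (\<eta> * ((a * norm u + 1) / 2)) + \<eta> / 4 * (a * norm u)"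
          using kv mult_left_mono[OF nv, of \<eta>] \<eta> by linarith
        also have "\<dots> \<le> - \<eta> / 2" using \<eta> a0 by (simp add: field_simps)
        finally have "fwd k + a * d \<le> - \<eta> / 2" .
        moreover have "delay (lens (hmult k g)) \<le> delay (lens g) + a * d + b / 2 * d\<^sup>2"
          using delay_mono[OF ld] delay_step[of "lens g" d] unfolding a_def by linarith
        ultimately have "fwd (hmult k g) + delay (lens (hmult k g)) \<le> fwd g + delay (lens g) - \<eta> / 4"
          using bd unfolding fwd_hmult by linarith
        then have "fwd (hmult k g) + delay (lens (hmult k g)) < H"
          using g by (auto simp: front_def)
        moreover have "lens (hmult k g) < M"
          using wall[OF lg True k u(1) u2 u(3) desc[OF k] a_def] kv by (simp add: v_def)
        ultimately have "hmult k g \<in> front H" using fwd_nonneg[OF k] by (simp add: front_def)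
        then show "hmult k g \<in> G" using H(2) by blast
      qed
    next
      case False
      show ?thesis
      proof (rule filledD[OF G, of "- e"])
        show "- e \<noteq> 0" using e by auto
        show "- e \<bullet> e \<le> \<eta> * norm (- e)" using \<eta> e by simp
      next
        fix k :: "'n heis" assume k: "k \<in> window D" and kv: "\<eta> * norm (- e) < - e \<bullet> horiz k"
        have "C * (norm (perp g))\<^sup>2 \<le> m0" using norm_perp_lens[of g] False by linarith
        then have "norm (perp g) \<le> sqrt (m0 / C)"
          using C_ge by (intro real_le_rsqrt) (simp add: field_simps)
        then have "4 * C * D * (norm (perp g) + c0) \<le> 4 * C * D * (sqrt (m0 / C) + c0)"
          using C_ge D by (intro mult_left_mono) auto
        then have lk: "lens (hmult k g) \<le> m1"
          using lens_change[OF k, of g] False unfolding m1_def by linarith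
        have "fwd k < - \<eta>" using kv e by (simp add: fwd_def inner_commute)
        moreover have "delay (lens (hmult k g)) = 0" using lk by (simp add: delay_def)
        ultimately have "fwd (hmult k g) + delay (lens (hmult k g)) < H"
          using g delay_nonneg[of "lens g"] \<eta> by (auto simp: front_def fwd_hmult)
        then have "hmult k g \<in> front H" using fwd_nonneg[OF k] lk M_ge by (simp add: front_def)
        then show "hmult k g \<in> G" using H(2) by blast
      qed
    qed
  qed
qed

text \<open>The front advances by the fixed amount \<open>\<eta> / 4\<close>, so it eventually
  passes every point of the half-infinite tube.\<close>

lemma fill_forward:
  assumes G: "filled e \<eta> D G" and "base \<subseteq> G" and g: "0 \<le> fwd g" "lens g < M"
  shows "g \<in> G"
proof -
  have *: "front (H0 + real n * (\<eta> / 4)) \<subseteq> G" for n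
  proof (induction n)
    case 0
    have "front H0 \<subseteq> base"
      using delay_nonneg by (auto simp: front_def base_def) (smt (verit))
    then show ?case using assms(2) by simp
  next
    case (Suc n)
    have "H0 \<le> H0 + real n * (\<eta> / 4)" using \<eta> by simp
    from front_step[OF G this Suc] show ?case by (simp add: field_simps)
  qed
  obtain n where "fwd g + delay (lens g) - H0 < real n * (\<eta> / 4)"
    using reals_Archimedean3[of "\<eta> / 4"] \<eta> by (meson divide_pos_pos zero_less_numeral)
  then have "g \<in> front (H0 + real n * (\<eta> / 4))" using g by (auto simp: front_def)
  then show ?thesis using * by blast
qed

text \<open>Induction on the level of the lens: a window step along the descent vector
  \<open>u\<close> lowers the lens by at least \<open>1\<close>, since
  \<open>2 \<le> \<eta> * norm u\<close>.\<close>

lemma fill_everything: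
  assumes G: "filled e \<eta> D G" and base: "\<And>g. lens g < M \<Longrightarrow> g \<in> G"
  shows "g \<in> G"
proof -
  have *: "lens g < M + real n \<Longrightarrow> g \<in> G" for n g
  proof (induction n arbitrary: g)
    case 0
    then show ?case using base by simp
  next
    case (Suc n)
    show ?case
    proof (cases "lens g < M")
      case False
      then have "m0 \<le> lens g" using M_ge m1_ge by linarith
      obtain u where u: "2 * c0 \<le> norm u" "norm u \<le> 4 * C * (norm (perp g) + c0)"
        "u \<bullet> e \<le> 2 / C * norm u"
        and desc: "\<And>k. k \<in> window D \<Longrightarrow> lens (hmult k g) \<le> lens g - u \<bullet> horiz k + \<eta> / 4 * norm u"
        by (rule lens_descent[OF \<open>m0 \<le> lens g\<close>]) blast
      show ?thesis
      proof (rule filledD[OF G, of u])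
        show "u \<noteq> 0" using u(1) c0_ge by auto
        have "2 / C * norm u \<le> \<eta> * norm u"
          using C_ge D by (intro mult_right_mono) (auto simp: field_simps)
        then show "u \<bullet> e \<le> \<eta> * norm u" using u(3) by linarith
      next
        fix k :: "'n heis" assume k: "k \<in> window D" and ku: "\<eta> * norm u < u \<bullet> horiz k"
        have "\<eta> * (2 * c0) \<le> \<eta> * norm u" using u(1) \<eta> by (intro mult_left_mono) auto
        then have "2 \<le> \<eta> * norm u" using c0_ge(1) c1_ge by (simp add: mult_ac)
        then have "lens (hmult k g) \<le> lens g - 1" using desc[OF k] ku by linarith
        then show "hmult k g \<in> G" using Suc.prems by (intro Suc.IH) simp
      qed
    qed (rule base)
  qed
  obtain n where "lens g - M < real n" using reals_Archimedean2 by blast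
  then show ?thesis by (intro *[of _ n]) simp
qed

text \<open>The lens controls \<open>perp\<close>, and \<open>skew\<close> as well because it enters
  the two paraboloids with opposite signs. Boundedness makes \<open>base\<close> finite, as the
  pigeonhole argument requires.\<close>

lemma base_bounded: "\<exists>R. base \<subseteq> window R"
proof (intro exI subsetI)
  fix g assume g: "g \<in> base"
  define N where "N = sqrt (M / C)"
  have N: "norm (perp g) \<le> N" unfolding N_def
    using norm_perp_lens[of g] g C_ge by (intro real_le_rsqrt) (simp add: base_def field_simps)
  have f: "\<bar>fwd g\<bar> \<le> H0" using g by (simp add: base_def)
  have sd: "\<bar>side g\<bar> \<le> N" using side_le[of g] N by simp
  have N0: "0 \<le> N" using N norm_ge_zero order_trans by blast
  have "norm (horiz g) \<le> norm (perp g) + norm (fwd g *\<^sub>R e)"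
    using norm_triangle_ineq[of "perp g" "fwd g *\<^sub>R e"] by (simp add: perp_def)
  then have 1: "norm (horiz g) \<le> N + H0" using N f e by simp
  have sc: "\<bar>2 * C * c0 * side g\<bar> \<le> 2 * C * c0 * N"
    unfolding abs_mult using sd C_ge c0_ge by (intro mult_mono) auto
  have "par 1 g < M" "par (-1) g < M" using g by (auto simp: base_def lens_def)
  moreover have "par 1 g = skew g + C * (norm (perp g))\<^sup>2 + 2 * C * c0 * side g"
    "par (-1) g = - skew g + C * (norm (perp g))\<^sup>2 - 2 * C * c0 * side g"
    by (simp_all add: par_def)
  moreover have "0 \<le> C * (norm (perp g))\<^sup>2" using C_ge by simp
  ultimately have "\<bar>skew g\<bar> \<le> M + 2 * C * c0 * N"
    using sc by linarith
  moreover have "\<bar>2 * side g * fwd g\<bar> \<le> 2 * N * H0"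
    unfolding abs_mult using sd f N0 by (intro mult_mono) auto
  ultimately have "\<bar>height g\<bar> \<le> M + 2 * C * c0 * N + 2 * N * H0"
    unfolding skew_def by linarith
  moreover have "0 \<le> 2 * N * H0" "0 \<le> H0" using N0 f by (auto simp: mult_nonneg_nonneg)
  moreover have "0 \<le> 2 * C * c0 * N" "0 \<le> M" using N0 C_ge c0_ge M_ge by auto
  ultimately show "g \<in> window (N + H0 + (M + 2 * C * c0 * N + 2 * N * H0))"
    using 1 N0 by (simp add: window_def)
qed

lemma shift_fwd:
  assumes "horiz r = \<tau> *\<^sub>R e" "height r = 0"
  shows "fwd (hmult g r) = fwd g + \<tau>" "lens (hmult g r) = lens g"
proof -
  show 1: "fwd (hmult g r) = fwd g + \<tau>" using assms by (simp add: fwd_def inner_add)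
  have 2: "side (hmult g r) = side g" "perp (hmult g r) = perp g"
    using assms by (simp_all add: side_def perp_def fwd_def inner_add algebra_simps)
  have "skew (hmult g r) = skew g"
    using assms 1 2 by (simp add: skew_def height_hmult side_def inner_commute algebra_simps)
  with 2 show "lens (hmult g r) = lens g" by (simp add: lens_def par_def)
qed

end

section \<open>Busemann horofunctions\<close>

definition busemann :: "(real ^ 'n) \<times> (real ^ 'n) \<Rightarrow> ('n::finite) heis \<Rightarrow> real" where
  "busemann \<nu> g = - (\<nu> \<bullet> horiz g)"

lemma norm_Pair_power4: "norm (a, b) ^ 4 = ((norm a)\<^sup>2 + (norm b)\<^sup>2)\<^sup>2"
proof -
  have "norm (a, b) ^ 4 = ((norm (a, b))\<^sup>2)\<^sup>2" by (simp flip: power_mult)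
  then show ?thesis by (simp add: norm_Pair)
qed

text \<open>For \<open>c = 0\<close> the constraint says that \<open>(a, b)\<close> is a unit
  vector, and then \<open>horoV a b 0\<close> is its negative.\<close>

lemma busemann_border_eq: "busemann_border = busemann ` sphere 0 1"
proof -
  have *: "horofun a b 0 = busemann (a, b)" if "norm (a, b) = 1" for a b :: "real ^ 'n"
  proof -
    have "(norm a)\<^sup>2 + (norm b)\<^sup>2 = 1" using that by (simp add: norm_Pair)
    then show ?thesis by (auto simp: fun_eq_iff busemann_def horoV_def inner_prod_def)
  qed
  have "((norm a)\<^sup>2 + (norm b)\<^sup>2)\<^sup>2 = 1 \<longleftrightarrow> norm (a, b) = 1" for a b :: "real ^ 'n"
    unfolding norm_Pair_power4[symmetric] 
    by (metis norm_ge_zero power_eq_imp_eq_base power_one zero_le_one zero_less_numeral)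
  then have "busemann_border = {horofun a b 0 | a b. norm (a, b) = (1 :: real)}"
    unfolding busemann_border_def by auto
  also have "\<dots> = {busemann (a, b) | a b. norm (a, b) = 1}" using * by metis
  also have "\<dots> = busemann ` sphere 0 1" by force
  finally show ?thesis .
qed

lemma koranyi_norm_eq: "koranyi_norm g = root 4 (norm (horiz g) ^ 4 + (height g)\<^sup>2)"
  by (cases g) (simp add: norm_Pair_power4)

text \<open>The correction is chosen so that the linear term in the expansion of the fourth power
  equals the squared height. It tends to \<open>0\<close> even if the height grows as fast as the
  norm of the horizontal part.\<close>

lemma koranyi_norm_bounds:
  assumes "horiz g \<noteq> 0"
  shows "norm (horiz g) \<le> koranyi_norm g"
    "koranyi_norm g \<le> norm (horiz g) + (height g)\<^sup>2 / (4 * norm (horiz g) ^ 3)"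
proof -
  define A where "A = norm (horiz g)"
  have A: "A > 0" using assms by (simp add: A_def)
  have root: "root 4 (r ^ 4) = r" if "0 \<le> r" for r :: real
    using that by (intro real_root_power_cancel) auto
  have "A = root 4 (A ^ 4)" using root A by simp
  also have "\<dots> \<le> root 4 (A ^ 4 + (height g)\<^sup>2)" by simp
  finally show "norm (horiz g) \<le> koranyi_norm g" by (simp add: koranyi_norm_eq A_def)
  define d where "d = (height g)\<^sup>2 / (4 * A ^ 3)"
  have d: "d \<ge> 0" using A by (simp add: d_def)
  have "A ^ 4 + (height g)\<^sup>2 = A ^ 4 + 4 * A ^ 3 * d" using A by (simp add: d_def)
  also have "\<dots> \<le> A ^ 4 + 4 * A ^ 3 * d + (6 * A\<^sup>2 * d\<^sup>2 + 4 * A * d ^ 3 + d ^ 4)"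
    using A d by simp
  also have "\<dots> = (A + d) ^ 4" by algebra
  finally have "root 4 (A ^ 4 + (height g)\<^sup>2) \<le> root 4 ((A + d) ^ 4)" by simp
  also have "\<dots> = A + d" using A d by (intro root) simp
  finally show "koranyi_norm g \<le> norm (horiz g) + (height g)\<^sup>2 / (4 * norm (horiz g) ^ 3)"
    by (simp add: koranyi_norm_eq A_def d_def)
qed

text \<open>The third component makes the height bounded, so that the Koranyi norm is asymptotically the
  norm of the horizontal part.\<close>

definition "near_ray (\<nu> :: (real ^ 'n) \<times> (real ^ 'n)) (n::nat) =
  (let v = (\<chi> i. \<lfloor>real n * fst \<nu> $ i\<rfloor>); u = (\<chi> i. \<lfloor>real n * snd \<nu> $ i\<rfloor>)
   in (v, u, idot v u div 2) :: ('n::finite) heis)"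

lemma height_near_ray: "\<bar>height (near_ray \<nu> n)\<bar> \<le> 2"
proof -
  have "\<bar>2 * real_of_int i - 4 * real_of_int (i div 2)\<bar> \<le> 2" for i :: int
    by linarith
  then show ?thesis by (simp add: near_ray_def Let_def inner_rvec)
qed

lemma horiz_near_ray:
  fixes \<nu> :: "(real ^ 'n::finite) \<times> (real ^ 'n)"
  shows "\<exists>B. \<forall>n. norm (horiz (near_ray \<nu> n) - real n *\<^sub>R \<nu>) \<le> B"
proof (intro exI allI)
  fix n
  have f: "norm (rvec (\<chi> i. \<lfloor>real n * a $ i\<rfloor>) - real n *\<^sub>R a) \<le> real CARD('n)" for a :: "real ^ 'n"
  proof -
    have "norm (rvec (\<chi> i. \<lfloor>real n * a $ i\<rfloor>) - real n *\<^sub>R a) \<le>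
        (\<Sum>i\<in>UNIV. \<bar>(rvec (\<chi> i. \<lfloor>real n * a $ i\<rfloor>) - real n *\<^sub>R a) $ i\<bar>)"
      by (rule norm_le_l1_cart)
    also have "\<dots> \<le> (\<Sum>i\<in>(UNIV::'n set). 1)"
    proof (rule sum_mono)
      fix i :: 'n
      show "\<bar>(rvec (\<chi> i. \<lfloor>real n * a $ i\<rfloor>) - real n *\<^sub>R a) $ i\<bar> \<le> 1"
        by (simp add: rvec_def) linarith
    qed
    finally show ?thesis by simp
  qed
  have "norm (horiz (near_ray \<nu> n) - real n *\<^sub>R \<nu>) \<le>
    norm (fst (horiz (near_ray \<nu> n) - real n *\<^sub>R \<nu>)) + norm (snd (horiz (near_ray \<nu> n) - real n *\<^sub>R \<nu>))"
    by (metis norm_Pair_le prod.collapse)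
  also have "\<dots> \<le> real CARD('n) + real CARD('n)"
    using f[of "fst \<nu>"] f[of "snd \<nu>"] by (intro add_mono) (simp_all add: near_ray_def Let_def)
  finally show "norm (horiz (near_ray \<nu> n) - real n *\<^sub>R \<nu>) \<le> real CARD('n) + real CARD('n)" .
qed

section \<open>Norm asymptotics at bounded distance from a ray\<close>

context
  fixes p :: "nat \<Rightarrow> 'a::real_inner" and \<nu> :: 'a and B :: real
  assumes \<nu>: "norm \<nu> = 1" and B: "\<And>n. norm (p n - real n *\<^sub>R \<nu>) \<le> B"
begin

lemma near_ray_norm: "\<bar>norm (p n) - real n\<bar> \<le> B"
  using norm_triangle_ineq3[of "p n" "real n *\<^sub>R \<nu>"] B[of n] \<nu> by simp

lemma near_ray_at_top: "filterlim (\<lambda>n. norm (p n)) at_top sequentially"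
proof (rule filterlim_at_top_mono)
  show "filterlim (\<lambda>n. - B + real n) at_top sequentially"
    by (intro filterlim_tendsto_add_at_top[OF tendsto_const] filterlim_real_sequentially)
  show "\<forall>\<^sub>F n in sequentially. - B + real n \<le> norm (p n)"
    by (rule always_eventually) (use near_ray_norm in \<open>smt (verit)\<close>)
qed

lemma near_ray_inverse: "(\<lambda>n. inverse (norm (p n))) \<longlonglongrightarrow> 0"
  by (rule tendsto_inverse_0_at_top[OF near_ray_at_top])

lemma near_ray_pos: "\<forall>\<^sub>F n in sequentially. norm (p n) > 0"
  using near_ray_at_top unfolding filterlim_at_top_dense by blast

lemma near_ray_direction: "(\<lambda>n. p n /\<^sub>R norm (p n)) \<longlonglongrightarrow> \<nu>"
proof (rule Lim_transform2)
  show "(\<lambda>n. \<nu>) \<longlonglongrightarrow> \<nu>" by simp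
  have "norm (\<nu> - p n /\<^sub>R norm (p n)) \<le> 2 * B * inverse (norm (p n))" if "norm (p n) > 0" for n
  proof -
    have "\<nu> - p n /\<^sub>R norm (p n) = inverse (norm (p n)) *\<^sub>R ((norm (p n) - real n) *\<^sub>R \<nu> - (p n - real n *\<^sub>R \<nu>))"
      using that by (simp add: algebra_simps)
    also have "norm \<dots> = inverse (norm (p n)) * norm ((norm (p n) - real n) *\<^sub>R \<nu> - (p n - real n *\<^sub>R \<nu>))"
      by simp
    also have "\<dots> \<le> inverse (norm (p n)) * (norm ((norm (p n) - real n) *\<^sub>R \<nu>) + norm (p n - real n *\<^sub>R \<nu>))"
      by (intro mult_left_mono norm_triangle_ineq4) auto
    also have "\<dots> \<le> inverse (norm (p n)) * (B + B)"
      using near_ray_norm[of n] B[of n] \<nu> by (intro mult_left_mono add_mono) auto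
    finally show ?thesis by (simp add: mult_ac)
  qed
  then have "\<forall>\<^sub>F n in sequentially. norm (\<nu> - p n /\<^sub>R norm (p n)) \<le> 2 * B * inverse (norm (p n))"
    using near_ray_pos by (auto elim: eventually_mono)
  moreover have "(\<lambda>n. 2 * B * inverse (norm (p n))) \<longlonglongrightarrow> 0"
    using tendsto_mult_left[OF near_ray_inverse, of "2 * B"] by simp
  ultimately show "(\<lambda>n. \<nu> - p n /\<^sub>R norm (p n)) \<longlonglongrightarrow> 0" by (rule Lim_null_comparison)
qed

lemma near_ray_quotient: "(\<lambda>n. norm (p n - q) / norm (p n)) \<longlonglongrightarrow> 1"
proof -
  have "(\<lambda>n. norm (p n /\<^sub>R norm (p n) - inverse (norm (p n)) *\<^sub>R q)) \<longlonglongrightarrow> norm (\<nu> - 0 *\<^sub>R q)"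
    by (intro tendsto_intros near_ray_direction near_ray_inverse)
  moreover have "norm (p n /\<^sub>R norm (p n) - inverse (norm (p n)) *\<^sub>R q) = norm (p n - q) / norm (p n)" for n
    by (simp add: scaleR_diff_right[symmetric] divide_inverse)
  ultimately show ?thesis using \<nu> by simp
qed

text \<open>Write the difference of norms as the difference of their squares over their sum and
  divide both by \<open>norm (p n)\<close>.\<close>

lemma near_ray_diff: "(\<lambda>n. norm (p n - q) - norm (p n)) \<longlonglongrightarrow> - (\<nu> \<bullet> q)"
proof -
  have "(\<lambda>n. ((norm q)\<^sup>2 * inverse (norm (p n)) - 2 * ((p n /\<^sub>R norm (p n)) \<bullet> q)) / (norm (p n - q) / norm (p n) + 1))
     \<longlonglongrightarrow> ((norm q)\<^sup>2 * 0 - 2 * (\<nu> \<bullet> q)) / (1 + 1)"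
    by (intro tendsto_intros near_ray_direction near_ray_inverse near_ray_quotient) simp
  moreover have "\<forall>\<^sub>F n in sequentially. ((norm q)\<^sup>2 * inverse (norm (p n)) - 2 * ((p n /\<^sub>R norm (p n)) \<bullet> q)) /
      (norm (p n - q) / norm (p n) + 1) = norm (p n - q) - norm (p n)"
    using near_ray_pos
  proof eventually_elim
    case (elim n)
    define r where "r = norm (p n)"
    define t where "t = norm (p n - q)"
    have "t\<^sup>2 = r\<^sup>2 - 2 * (p n \<bullet> q) + (norm q)\<^sup>2"
      by (simp add: t_def r_def power2_norm_eq_inner inner_diff inner_commute)
    then have *: "(norm q)\<^sup>2 - 2 * (p n \<bullet> q) = (t - r) * (t + r)"
      by (simp add: algebra_simps power2_eq_square)
    have rt: "r > 0" "t / r + 1 \<noteq> 0" using elim by (auto simp: r_def t_def add_nonneg_eq_0_iff)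
    have "(norm q)\<^sup>2 * inverse r - 2 * ((p n /\<^sub>R r) \<bullet> q) = ((norm q)\<^sup>2 - 2 * (p n \<bullet> q)) / r"
      by (simp add: divide_inverse algebra_simps)
    also have "\<dots> = (t - r) * (t / r + 1)" using rt(1) by (simp add: * field_simps)
    finally show ?case
      unfolding r_def[symmetric] t_def[symmetric] using rt(2) by simp
  qed
  ultimately show ?thesis by (simp add: tendsto_cong)
qed

end

text \<open>The height of the product is \<open>norm (p n)\<close> times a convergent factor, so the
  error in \<open>koranyi_norm_bounds\<close> has order \<open>inverse (norm (p n))\<close>;
  \<open>?f\<close> is this error in terms of convergent ratios.\<close>

lemma koranyi_norm_near_ray:
  assumes "norm \<nu> = 1"
  shows "(\<lambda>n. koranyi_norm (hmult (near_ray \<nu> n) x) - norm (horiz (near_ray \<nu> n) + horiz x)) \<longlonglongrightarrow> 0"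
proof -
  define p where "p n = horiz (near_ray \<nu> n)" for n
  obtain B where B: "\<And>n. norm (p n - real n *\<^sub>R \<nu>) \<le> B"
    using horiz_near_ray[of \<nu>] by (auto simp: p_def)
  note lims = near_ray_inverse[OF assms B] near_ray_direction[OF assms B]
    near_ray_quotient[OF assms B, of "- horiz x"]
  let ?r = "\<lambda>n. norm (p n)" and ?g = "\<lambda>n. hmult (near_ray \<nu> n) x"
  let ?h = "\<lambda>n. height (near_ray \<nu> n) * inverse (?r n) + height x * inverse (?r n)
     + 2 * (rot (horiz x) \<bullet> (p n /\<^sub>R ?r n))"
  let ?f = "\<lambda>n. (?h n)\<^sup>2 / (4 * (norm (p n - (- horiz x)) / ?r n) ^ 3) * inverse (?r n)"
  have h0: "(\<lambda>n. height (near_ray \<nu> n) * inverse (?r n)) \<longlonglongrightarrow> 0"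
  proof (rule Lim_null_comparison)
    show "\<forall>\<^sub>F n in sequentially. norm (height (near_ray \<nu> n) * inverse (?r n)) \<le> 2 * inverse (?r n)"
      by (rule always_eventually) (auto simp: abs_mult intro!: mult_right_mono height_near_ray)
    show "(\<lambda>n. 2 * inverse (?r n)) \<longlonglongrightarrow> 0"
      using tendsto_mult_left[OF lims(1), of 2] by simp
  qed
  have "?f \<longlonglongrightarrow> (0 + height x * 0 + 2 * (rot (horiz x) \<bullet> \<nu>))\<^sup>2 / (4 * 1 ^ 3) * 0"
    by (intro tendsto_intros lims h0) simp
  then have f0: "?f \<longlonglongrightarrow> 0" by simp
  have cancel: "(r * h)\<^sup>2 / (4 * t ^ 3) = h\<^sup>2 / (4 * (t / r) ^ 3) * inverse r"
    if "r > 0" "t > 0" for r t h :: real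
    using that by (simp add: field_simps power2_eq_square power3_eq_cube)
  have "\<forall>\<^sub>F n in sequentially. norm (p n - (- horiz x)) / ?r n > 0"
    using order_tendstoD(1)[OF lims(3), of 0] by simp
  then have "\<forall>\<^sub>F n in sequentially. norm (koranyi_norm (?g n) - norm (p n + horiz x)) \<le> ?f n"
    using near_ray_pos[OF assms B]
  proof eventually_elim
    case (elim n)
    have nz: "horiz (?g n) \<noteq> 0" and hz: "horiz (?g n) = p n + horiz x" using elim by (auto simp: p_def)
    have "height (?g n) = ?r n * ?h n"
      using elim(2) by (simp add: height_hmult p_def algebra_simps)
    moreover have "norm (horiz (?g n)) = norm (p n - - horiz x)" "0 < norm (p n - - horiz x)"
      using elim by (auto simp: p_def zero_less_divide_iff)
    ultimately have "(height (?g n))\<^sup>2 / (4 * norm (horiz (?g n)) ^ 3) = ?f n"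
      using cancel[OF elim(2)] by simp
    then show ?case using koranyi_norm_bounds[OF nz] by (simp add: p_def)
  qed
  then show ?thesis unfolding p_def[symmetric] using f0 by (rule Lim_null_comparison)
qed

text \<open>Along \<open>near_ray \<nu>\<close> the Koranyi distances may be replaced by norms of
  horizontal differences, to which \<open>near_ray_diff\<close> applies.\<close>

lemma busemann_in_border:
  assumes "norm \<nu> = 1" shows "busemann \<nu> \<in> border"
proof -
  define g where "g = near_ray \<nu>"
  define p where "p n = horiz (g n)" for n
  obtain B where B: "\<And>n. norm (p n - real n *\<^sub>R \<nu>) \<le> B"
    using horiz_near_ray[of \<nu>] by (auto simp: p_def g_def)
  have k: "(\<lambda>n. koranyi_dist (g n) x - norm (p n - horiz x)) \<longlonglongrightarrow> 0" for x
  proof -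
    have "horiz (inv\<^bsub>Heis\<^esub> x) = - horiz x" by (cases x) (simp add: inv_Heis)
    then show ?thesis
      using koranyi_norm_near_ray[OF assms, of "inv\<^bsub>Heis\<^esub> x"] by (simp add: koranyi_dist_def g_def p_def)
  qed
  have h0: "horiz (\<one>\<^bsub>Heis\<^esub> :: 'a heis) = 0" by (simp add: prod_eq_iff)
  have "(\<lambda>n. koranyi_dist (g n) x - koranyi_dist (g n) \<one>\<^bsub>Heis\<^esub>) \<longlonglongrightarrow> busemann \<nu> x" for x
    using tendsto_add[OF tendsto_diff[OF k[of x] k[of "\<one>\<^bsub>Heis\<^esub>"]] near_ray_diff[OF assms B, of "horiz x"]]
    by (simp add: h0 busemann_def del: Heis_simps)
  moreover have "filterlim (\<lambda>n. koranyi_dist (g n) \<one>\<^bsub>Heis\<^esub>) at_top sequentially"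
    using filterlim_tendsto_add_at_top[OF k[of "\<one>\<^bsub>Heis\<^esub>"] near_ray_at_top[OF assms B]]
    by (simp add: h0 del: Heis_simps)
  ultimately show ?thesis unfolding border_def by blast
qed

section \<open>Nondeterministic directions\<close>

lemma finite_window: "finite (window R :: 'n::finite heis set)"
proof -
  define N where "N = \<lceil>R\<rceil>"
  define V where "V = {v :: int ^ 'n. \<forall>i. v $ i \<in> {-N..N}}"
  have "V \<subseteq> vec_lambda ` (UNIV \<rightarrow>\<^sub>E {-N..N})"
    by (auto simp: V_def image_iff intro!: bexI[of _ "vec_nth _"])
  moreover have "finite (UNIV \<rightarrow>\<^sub>E {-N..N} :: ('n \<Rightarrow> int) set)" by (intro finite_PiE) auto
  ultimately have V: "finite V" by (meson finite_imageI finite_subset)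
  have comp: "v \<in> V" if "norm (rvec v) \<le> R" for v
    unfolding V_def
  proof (intro CollectI allI)
    fix i
    have "\<bar>rvec v $ i\<bar> \<le> R" using component_le_norm_cart[of "rvec v" i] that by simp
    then show "v $ i \<in> {-N..N}" unfolding N_def rvec_def by (simp; linarith)
  qed
  define W where "W = Sigma V (\<lambda>v. Sigma V (\<lambda>u. {t. \<bar>2 * idot v u - 4 * t\<bar> \<le> N}))"
  have "finite {t. \<bar>2 * a - 4 * t\<bar> \<le> N}" for a :: int
    by (rule finite_subset[of _ "{- \<bar>a\<bar> - \<bar>N\<bar>..\<bar>a\<bar> + \<bar>N\<bar>}"]) auto
  then have "finite W" unfolding W_def using V by (intro finite_SigmaI) auto
  moreover have "window R \<subseteq> W"
  proof
    fix g :: "'n heis" assume g: "g \<in> window R"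
    obtain v u t where f: "g = (v, u, t)" by (cases g)
    have n: "norm (rvec v, rvec u) \<le> R" using g by (simp add: f window_def)
    have "norm (rvec v) \<le> R" "norm (rvec u) \<le> R"
      using norm_fst_le[of "rvec v" "rvec u"] norm_snd_le[of "rvec u" "rvec v"] n by linarith+
    moreover have "\<bar>2 * idot v u - 4 * t\<bar> \<le> N"
    proof -
      have "real_of_int \<bar>2 * idot v u - 4 * t\<bar> \<le> R" using g by (simp add: f window_def inner_rvec)
      then show ?thesis unfolding N_def by linarith
    qed
    ultimately show "g \<in> W" using comp by (simp add: f W_def)
  qed
  ultimately show ?thesis by (rule finite_subset[rotated])
qed

lemma norm_limit:
  fixes \<nu> :: "nat \<Rightarrow> 'a::real_normed_vector"
  assumes "\<nu> \<longlonglongrightarrow> \<mu>" "\<And>n. norm (\<nu> n) = 1"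
  shows "norm \<mu> = 1"
proof -
  have "(\<lambda>n. norm (\<nu> n)) \<longlonglongrightarrow> norm \<mu>" using assms(1) by (rule tendsto_norm)
  then show ?thesis by (simp add: assms(2) LIMSEQ_const_iff)
qed

text \<open>What the factor map contributes: lying in one fiber is a closed relation, by
  \<open>cont\<close>, and an invariant one, by \<open>invar\<close>.\<close>

locale heis_fibers = heis_tds X T
  for X :: "'x::metric_space set" and T :: "('n::finite) heis \<Rightarrow> 'x \<Rightarrow> 'x" +
  fixes \<pi> :: "'x \<Rightarrow> 'y::metric_space"
  assumes cont: "continuous_on X \<pi>"
    and invar: "\<And>g x y. x \<in> X \<Longrightarrow> y \<in> X \<Longrightarrow> \<pi> x = \<pi> y \<Longrightarrow> \<pi> (T g x) = \<pi> (T g y)"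
begin

definition "close \<epsilon> x y = {g. dist (T g x) (T g y) \<le> \<epsilon>}"

definition "directions \<epsilon> = {\<nu>. norm \<nu> = 1 \<and> (\<exists>x\<in>X. \<exists>y\<in>X. x \<noteq> y \<and> \<pi> x = \<pi> y \<and>
  {g. 0 < \<nu> \<bullet> horiz g} \<subseteq> close \<epsilon> x y)}"

lemma T_in: "x \<in> X \<Longrightarrow> T g x \<in> X" using maps_to[of g] by blast

lemma T_hmult: "x \<in> X \<Longrightarrow> T k (T g x) = T (hmult k g) x"
  using action_mult[of x k g] by simp

text \<open>Moving a pair by the action right-translates its closeness set, in accordance with
  \<open>filled_translate\<close>.\<close>

lemma close_T: "x \<in> X \<Longrightarrow> y \<in> X \<Longrightarrow> close \<epsilon> (T q x) (T q y) = {g. hmult g q \<in> close \<epsilon> x y}"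
  by (simp add: close_def T_hmult)

lemma T_one: "x \<in> X \<Longrightarrow> T (0, 0, 0) x = x" using action_one by simp

lemma inj_T: "inj_on (T g) X"
proof (rule inj_onI)
  fix x y assume xy: "x \<in> X" "y \<in> X" "T g x = T g y"
  have *: "hmult (inv\<^bsub>Heis\<^esub> g) g = (0, 0, 0)"
    using group.l_inv[OF group_Heis, of g] by simp
  have "T (inv\<^bsub>Heis\<^esub> g) (T g z) = z" if "z \<in> X" for z
    by (simp only: T_hmult[OF that] * T_one[OF that])
  then show "x = y" using xy by metis
qed

lemma busemann_ND_eps: "ND_eps X T \<pi> \<epsilon> \<inter> busemann_border = busemann ` directions \<epsilon>"
proof -
  have "busemann \<nu> \<in> ND_eps X T \<pi> \<epsilon> \<longleftrightarrow> \<nu> \<in> directions \<epsilon>" if "norm \<nu> = 1" for \<nu>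
  proof -
    have *: "{g. busemann \<nu> g < 0} = {g. 0 < \<nu> \<bullet> horiz g}" by (simp add: busemann_def)
    show ?thesis
      unfolding ND_eps_def directions_def close_def mem_Collect_eq[of "busemann \<nu>"] *
      using that busemann_in_border[OF that] by blast
  qed
  moreover have "directions \<epsilon> \<subseteq> sphere 0 1" by (auto simp: directions_def)
  ultimately show ?thesis unfolding busemann_border_eq by auto
qed

lemma directions_all:
  assumes "x \<in> X" "y \<in> X" "x \<noteq> y" "\<pi> x = \<pi> y" "close \<epsilon> x y = UNIV" "norm \<nu> = 1"
  shows "\<nu> \<in> directions \<epsilon>"
  using assms unfolding directions_def by auto

lemma directions_mono: "\<epsilon> \<le> \<epsilon>' \<Longrightarrow> directions \<epsilon> \<subseteq> directions \<epsilon>'"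
  unfolding directions_def close_def by (auto simp: subset_iff) (meson order_trans)

section \<open>Compactness of the nondeterministic directions\<close>

text \<open>The lower bound \<open>\<epsilon> < dist x y\<close> keeps the limit points distinct; it is obtained below by
  translating a pair to a place where it is not \<open>\<epsilon>\<close>-close.\<close>

lemma limit_direction:
  fixes \<nu> :: "nat \<Rightarrow> (real ^ 'n) \<times> (real ^ 'n)"
  assumes \<epsilon>: "0 < \<epsilon>" and \<nu>: "\<nu> \<longlonglongrightarrow> \<mu>" "\<And>n. norm (\<nu> n) = 1"
    and pairs: "\<And>n. \<exists>x\<in>X. \<exists>y\<in>X. \<pi> x = \<pi> y \<and> \<epsilon> < dist x y \<and>
      (\<forall>k\<in>window (real n). inverse (real (Suc n)) < \<nu> n \<bullet> horiz k \<longrightarrow> k \<in> close \<epsilon> x y)"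
  shows "\<mu> \<in> directions \<epsilon>"
proof -
  obtain x y where xy: "\<And>n. x n \<in> X" "\<And>n. y n \<in> X" "\<And>n. \<pi> (x n) = \<pi> (y n)" "\<And>n. \<epsilon> < dist (x n) (y n)"
    and cl: "\<And>n k. k \<in> window (real n) \<Longrightarrow> inverse (real (Suc n)) < \<nu> n \<bullet> horiz k \<Longrightarrow> k \<in> close \<epsilon> (x n) (y n)"
    using pairs by metis
  have "seq_compact (X \<times> X)" using compact_space by (intro compact_imp_seq_compact compact_Times)
  moreover have "\<forall>n. (x n, y n) \<in> X \<times> X" using xy by simp
  ultimately obtain l r where l: "l \<in> X \<times> X" and r: "strict_mono r" and lim: "((\<lambda>n. (x n, y n)) \<circ> r) \<longlonglongrightarrow> l"
    by (rule seq_compactE)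
  define x' y' where "x' = fst l" and "y' = snd l"
  have X: "x' \<in> X" "y' \<in> X" using l by (auto simp: x'_def y'_def)
  have xl: "(\<lambda>n. x (r n)) \<longlonglongrightarrow> x'" and yl: "(\<lambda>n. y (r n)) \<longlonglongrightarrow> y'"
    using tendsto_fst[OF lim] tendsto_snd[OF lim] by (simp_all add: x'_def y'_def o_def)
  have tendsto: "(\<lambda>n. f (x (r n))) \<longlonglongrightarrow> f x'" "(\<lambda>n. f (y (r n))) \<longlonglongrightarrow> f y'"
    if "continuous_on X f" for f :: "'x \<Rightarrow> 'z::topological_space"
    using that xl yl X xy by (auto intro!: continuous_on_tendsto_compose[of X f] always_eventually)
  have "(\<lambda>n. \<pi> (x (r n))) \<longlonglongrightarrow> \<pi> y'" using tendsto(2)[OF cont] xy(3) by simp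
  then have "\<pi> x' = \<pi> y'" using tendsto(1)[OF cont] LIMSEQ_unique by blast
  moreover have "\<epsilon> \<le> dist x' y'"
    using xy(4) by (intro tendsto_lowerbound[OF tendsto_dist[OF xl yl]]) (auto intro!: always_eventually less_imp_le)
  then have "x' \<noteq> y'" using \<epsilon> by auto
  moreover have "k \<in> close \<epsilon> x' y'" if k: "0 < \<mu> \<bullet> horiz k" for k
  proof -
    have "(\<lambda>n. \<nu> n \<bullet> horiz k - inverse (real (Suc n))) \<longlonglongrightarrow> \<mu> \<bullet> horiz k - 0"
      by (intro tendsto_intros \<nu> LIMSEQ_inverse_real_of_nat)
    then have "\<forall>\<^sub>F n in sequentially. 0 < \<nu> n \<bullet> horiz k - inverse (real (Suc n))"
      using k by (intro order_tendstoD) auto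
    moreover obtain N where "max (norm (horiz k)) \<bar>height k\<bar> \<le> real N" using real_arch_simple by blast
    then have "\<forall>\<^sub>F n in sequentially. k \<in> window (real n)"
      by (auto simp: window_def eventually_sequentially intro!: exI[of _ N] elim: order_trans)
    ultimately have "\<forall>\<^sub>F n in sequentially. k \<in> close \<epsilon> (x n) (y n)"
      by eventually_elim (rule cl, assumption, linarith)
    then have "\<forall>\<^sub>F n in sequentially. k \<in> close \<epsilon> (x (r n)) (y (r n))"
      using r by (rule eventually_subseq[rotated])
    then have "\<forall>\<^sub>F n in sequentially. dist (T k (x (r n))) (T k (y (r n))) \<le> \<epsilon>"
      by (simp add: close_def)
    then have "dist (T k x') (T k y') \<le> \<epsilon>"
      by (rule tendsto_upperbound[OF tendsto_dist[OF tendsto[OF continuous]]]) simp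
    then show ?thesis by (simp add: close_def)
  qed
  moreover have "norm \<mu> = 1" using \<nu> by (rule norm_limit)
  ultimately show ?thesis using X unfolding directions_def by blast
qed

text \<open>Unless some pair is close everywhere, each pair is translated to an almost extremal
  point of non-closeness. There it is more than \<open>\<epsilon>\<close> apart, yet close on a
  slightly shrunken half-space, and \<open>limit_direction\<close> applies.\<close>

lemma closed_directions:
  assumes "0 < \<epsilon>" shows "closed (directions \<epsilon>)"
  unfolding closed_sequential_limits
proof (intro allI impI, elim conjE)
  fix \<nu> \<mu> assume D: "\<forall>n. \<nu> n \<in> directions \<epsilon>" and lim: "\<nu> \<longlonglongrightarrow> \<mu>"
  have n1: "norm (\<nu> n) = 1" for n using D by (auto simp: directions_def)
  have m1: "norm \<mu> = 1" using lim n1 by (rule norm_limit)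
  show "\<mu> \<in> directions \<epsilon>"
  proof (cases "\<exists>x\<in>X. \<exists>y\<in>X. x \<noteq> y \<and> \<pi> x = \<pi> y \<and> close \<epsilon> x y = UNIV")
    case True
    then show ?thesis using directions_all m1 by blast
  next
    case False
    show ?thesis
    proof (rule limit_direction[OF assms lim n1])
      fix n
      obtain x y where xy: "x \<in> X" "y \<in> X" "x \<noteq> y" "\<pi> x = \<pi> y"
        and sub: "{g. 0 < \<nu> n \<bullet> horiz g} \<subseteq> close \<epsilon> x y"
        using D unfolding directions_def by blast
      \<comment> \<open>The values of \<open>\<nu> n\<close> at the points of non-closeness;
        closeness on the open half-space bounds them by \<open>0\<close>.\<close>
      define V where "V = (\<lambda>g. \<nu> n \<bullet> horiz g) ` (- close \<epsilon> x y)"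
      have ne: "V \<noteq> {}" using False xy by (auto simp: V_def)
      have bdd: "bdd_above V" using sub by (intro bdd_aboveI[of _ 0]) (force simp: V_def)
      have "\<exists>v\<in>V. Sup V - inverse (real (Suc n)) < v"
        using less_cSup_iff[OF ne bdd, of "Sup V - inverse (real (Suc n))"] by simp
      then obtain g where g: "g \<notin> close \<epsilon> x y" "Sup V - inverse (real (Suc n)) < \<nu> n \<bullet> horiz g"
        by (auto simp: V_def)
      have "k \<in> close \<epsilon> (T g x) (T g y)" if "inverse (real (Suc n)) < \<nu> n \<bullet> horiz k" for k
      proof (rule ccontr)
        assume "k \<notin> close \<epsilon> (T g x) (T g y)"
        then have "hmult k g \<in> - close \<epsilon> x y" using xy by (simp add: close_T)
        then have "\<nu> n \<bullet> horiz (hmult k g) \<in> V" unfolding V_def by (rule imageI)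
        then have "\<nu> n \<bullet> horiz (hmult k g) \<le> Sup V" using bdd by (rule cSup_upper)
        then show False using that g(2) by (simp add: inner_add_right)
      qed
      moreover have "\<epsilon> < dist (T g x) (T g y)" using g(1) by (simp add: close_def)
      ultimately show "\<exists>x\<in>X. \<exists>y\<in>X. \<pi> x = \<pi> y \<and> \<epsilon> < dist x y \<and>
          (\<forall>k\<in>window (real n). inverse (real (Suc n)) < \<nu> n \<bullet> horiz k \<longrightarrow> k \<in> close \<epsilon> x y)"
        using T_in xy invar by blast
    qed
  qed
qed

text \<open>Otherwise every \<open>n\<close> has a counterexample; translated to the identity it is
  a pair more than \<open>\<epsilon>\<close> apart, and a limit of the normals is a nondeterministic
  \<open>\<mu>\<close> with \<open>\<mu> \<bullet> e \<le> 0\<close>. One \<open>n\<close> serves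
  all pairs.\<close>

lemma close_filled:
  assumes \<epsilon>: "0 < \<epsilon>" and none: "\<And>\<nu>. \<nu> \<in> directions \<epsilon> \<Longrightarrow> \<not> \<nu> \<bullet> e \<le> 0"
  obtains n where "\<And>x y. x \<in> X \<Longrightarrow> y \<in> X \<Longrightarrow> \<pi> x = \<pi> y \<Longrightarrow>
    filled e (inverse (real (Suc n))) (real (Suc n)) (close \<epsilon> x y)"
proof (rule ccontr)
  assume "\<not> thesis"
  then have "\<forall>n. \<exists>x\<in>X. \<exists>y\<in>X. \<pi> x = \<pi> y \<and>
    \<not> filled e (inverse (real (Suc n))) (real (Suc n)) (close \<epsilon> x y)"
    using that by blast
  then have "\<exists>x\<in>X. \<exists>y\<in>X. \<exists>\<nu>. \<pi> x = \<pi> y \<and> \<epsilon> < dist x y \<and> norm \<nu> = 1 \<and> \<nu> \<bullet> e \<le> inverse (real (Suc n)) \<and>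
     (\<forall>k\<in>window (real (Suc n)). inverse (real (Suc n)) < \<nu> \<bullet> horiz k \<longrightarrow> k \<in> close \<epsilon> x y)" for n
  proof -
    obtain x y g \<nu> where *: "x \<in> X" "y \<in> X" "\<pi> x = \<pi> y" "norm \<nu> = 1" "\<nu> \<bullet> e \<le> inverse (real (Suc n))"
      "\<And>k. k \<in> window (real (Suc n)) \<Longrightarrow> inverse (real (Suc n)) < \<nu> \<bullet> horiz k \<Longrightarrow> hmult k g \<in> close \<epsilon> x y"
      "g \<notin> close \<epsilon> x y"
      using \<open>\<forall>n. _\<close>[rule_format, of n] unfolding filled_def by blast
    then show ?thesis
      by (intro bexI[of _ "T g x"] bexI[of _ "T g y"] exI[of _ \<nu>])
        (auto simp: close_T T_in intro: invar, auto simp: close_def)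
  qed
  then obtain x y \<nu> where xy: "\<And>n. x n \<in> X" "\<And>n. y n \<in> X" "\<And>n. \<pi> (x n) = \<pi> (y n)" "\<And>n. \<epsilon> < dist (x n) (y n)"
    and \<nu>: "\<And>n. norm (\<nu> n) = 1" "\<And>n. \<nu> n \<bullet> e \<le> inverse (real (Suc n))"
    and cl: "\<And>n k. k \<in> window (real (Suc n)) \<Longrightarrow> inverse (real (Suc n)) < \<nu> n \<bullet> horiz k \<Longrightarrow> k \<in> close \<epsilon> (x n) (y n)"
    by metis
  have "\<forall>n. \<nu> n \<in> sphere 0 1" using \<nu> by simp
  with compact_imp_seq_compact[OF compact_sphere] obtain \<mu> r where r: "strict_mono r" and lim: "(\<nu> \<circ> r) \<longlonglongrightarrow> \<mu>"
    by (rule seq_compactE)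
  have rn: "n \<le> r n" for n using r by (rule seq_suble)
  have inv_le: "inverse (real (Suc (r n))) \<le> inverse (real (Suc n))" for n
    using rn[of n] by (intro le_imp_inverse_le) auto
  have "\<mu> \<in> directions \<epsilon>"
  proof (rule limit_direction[OF \<epsilon> lim])
    fix n
    have "k \<in> close \<epsilon> (x (r n)) (y (r n))"
      if "k \<in> window (real n)" "inverse (real (Suc n)) < \<nu> (r n) \<bullet> horiz k" for k
    proof (rule cl)
      show "k \<in> window (real (Suc (r n)))" using that(1) rn[of n] by (auto simp: window_def)
      show "inverse (real (Suc (r n))) < \<nu> (r n) \<bullet> horiz k" using that(2) inv_le[of n] by linarith
    qed
    then show "\<exists>x\<in>X. \<exists>y\<in>X. \<pi> x = \<pi> y \<and> \<epsilon> < dist x y \<and>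
          (\<forall>k\<in>window (real n). inverse (real (Suc n)) < (\<nu> \<circ> r) n \<bullet> horiz k \<longrightarrow> k \<in> close \<epsilon> x y)"
      using xy by (intro bexI[of _ "x (r n)"] bexI[of _ "y (r n)"]) auto
  qed (use \<nu> in simp)
  moreover have "\<mu> \<bullet> e \<le> 0"
  proof (rule LIMSEQ_le)
    show "(\<lambda>n. (\<nu> \<circ> r) n \<bullet> e) \<longlonglongrightarrow> \<mu> \<bullet> e" by (intro tendsto_intros lim)
    show "(\<lambda>n. inverse (real (Suc n))) \<longlonglongrightarrow> 0" by (rule LIMSEQ_inverse_real_of_nat)
    show "\<exists>N. \<forall>n\<ge>N. (\<nu> \<circ> r) n \<bullet> e \<le> inverse (real (Suc n))"

    proof (intro exI allI impI)
      show "(\<nu> \<circ> r) n \<bullet> e \<le> inverse (real (Suc n))" for n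
        using \<nu>(2)[of "r n"] inv_le[of n] unfolding o_def by linarith
    qed
  qed
  ultimately show False using none by blast
qed

text \<open>By uniform continuity some \<open>d\<close> makes points within distance
  \<open>d\<close> stay close on \<open>F\<close>; cover \<open>X\<close> by finitely many balls of
  radius \<open>d / 2\<close>.\<close>

lemma close_pigeonhole:
  assumes "finite F" "0 < \<epsilon>"
  obtains N where "\<And>P. P \<subseteq> X \<Longrightarrow> finite P \<Longrightarrow> N < card P \<Longrightarrow> \<exists>a\<in>P. \<exists>b\<in>P. a \<noteq> b \<and> F \<subseteq> close \<epsilon> a b"
proof -
  have "\<exists>\<delta>>0. \<forall>a\<in>X. \<forall>b\<in>X. dist a b < \<delta> \<longrightarrow> dist (T g a) (T g b) < \<epsilon>" for g
    using compact_uniformly_continuous[OF continuous compact_space] assms(2)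
    unfolding uniformly_continuous_on_def by (metis dist_commute)
  then obtain \<delta> where \<delta>: "\<And>g. \<delta> g > 0"
    "\<And>g a b. a \<in> X \<Longrightarrow> b \<in> X \<Longrightarrow> dist a b < \<delta> g \<Longrightarrow> dist (T g a) (T g b) < \<epsilon>" by metis
  \<comment> \<open>The element \<open>1\<close> keeps the minimum defined when \<open>F\<close> is
    empty.\<close>
  define d where "d = Min (insert 1 (\<delta> ` F))"
  have d: "d > 0" "\<And>g. g \<in> F \<Longrightarrow> d \<le> \<delta> g" using assms(1) \<delta>(1) by (auto simp: d_def)
  obtain K where K: "finite K" "X \<subseteq> (\<Union>x\<in>K. ball x (d / 2))"
    using seq_compact_imp_totally_bounded compact_imp_seq_compact[OF compact_space] d(1)
    by (metis half_gt_zero)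
  show thesis
  proof (rule that[of "card K"])
    fix P assume P: "P \<subseteq> X" "finite P" "card K < card P"
    have "\<forall>a\<in>P. \<exists>x. x \<in> K \<and> dist x a < d / 2" using K(2) P(1) unfolding ball_def by blast
    then obtain f where f: "\<And>a. a \<in> P \<Longrightarrow> f a \<in> K" "\<And>a. a \<in> P \<Longrightarrow> dist (f a) a < d / 2" by metis
    have "\<not> inj_on f P" using card_inj_on_le[of f P K] f(1) K(1) P(3) by auto
    then obtain a b where ab: "a \<in> P" "b \<in> P" "a \<noteq> b" "f a = f b" by (auto simp: inj_on_def)
    have X: "a \<in> X" "b \<in> X" using ab P(1) by blast+
    have "dist a b < d" using f(2)[OF ab(1)] f(2)[OF ab(2)] ab(4) dist_triangle_half_r by metis
    have "F \<subseteq> close \<epsilon> a b"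
    proof
      fix g assume "g \<in> F"
      from \<open>dist a b < d\<close> d(2)[OF this] have "dist a b < \<delta> g" by (rule less_le_trans)
      from less_imp_le[OF \<delta>(2)[OF X this]] show "g \<in> close \<epsilon> a b" unfolding close_def by (rule CollectI)
    qed
    then show "\<exists>a\<in>P. \<exists>b\<in>P. a \<noteq> b \<and> F \<subseteq> close \<epsilon> a b" using ab by blast
  qed
qed

section \<open>Nondeterministic directions in every half-space\<close>

text \<open>Large fibers give, for each \<open>j\<close>, a pair that is close on \<open>base\<close> translated by \<open>-j w\<close>. One pair
  serves infinitely many \<open>j\<close>, and filling forward from these translates gives the two-sided tube.\<close>

lemma directions_halfspace:
  assumes \<epsilon>: "0 < \<epsilon>" and w: "w = horiz (wv, wu, 0)" "w \<noteq> 0"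
    and fibers: "\<And>M::nat. \<exists>P. finite P \<and> P \<subseteq> X \<and> M < card P \<and> (\<forall>a\<in>P. \<forall>b\<in>P. \<pi> a = \<pi> b)"
  shows "\<exists>\<nu>\<in>directions \<epsilon>. \<nu> \<bullet> w \<le> 0"
proof (rule ccontr)
  assume none: "\<not> ?thesis"
  define e where "e = w /\<^sub>R norm w"
  have e: "norm e = 1" using w(2) by (simp add: e_def)
  have we: "w = norm w *\<^sub>R e" using w(2) by (simp add: e_def)
  have none': "\<not> \<nu> \<bullet> e \<le> 0" if "\<nu> \<in> directions \<epsilon>" for \<nu>
    using none that w(2) by (auto simp: e_def field_simps)
  obtain n where fil: "\<And>x y. x \<in> X \<Longrightarrow> y \<in> X \<Longrightarrow> \<pi> x = \<pi> y \<Longrightarrow>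
    filled e (inverse (real (Suc n))) (real (Suc n)) (close \<epsilon> x y)"
    using close_filled[OF \<epsilon> none'] by metis
  interpret filling e "inverse (real (Suc n))" "real (Suc n)"
    by unfold_locales (use e in \<open>auto simp: field_simps\<close>)
  have "finite base" using base_bounded finite_window finite_subset by metis
  then obtain N where N: "\<And>P. P \<subseteq> X \<Longrightarrow> finite P \<Longrightarrow> N < card P \<Longrightarrow> \<exists>a\<in>P. \<exists>b\<in>P. a \<noteq> b \<and> base \<subseteq> close \<epsilon> a b"
    using close_pigeonhole[OF _ \<epsilon>] by metis
  obtain P where P: "finite P" "P \<subseteq> X" "N < card P" "\<And>a b. a \<in> P \<Longrightarrow> b \<in> P \<Longrightarrow> \<pi> a = \<pi> b"
    using fibers[of N] by blast
  \<comment> \<open>The factor \<open>2\<close> makes the third coordinate that gives height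
    \<open>0\<close> an integer.\<close>
  define r where "r j = (int (2 * j) *s wv, int (2 * j) *s wu, 2 * int j ^ 2 * idot wv wu)" for j
  define q where "q j = inv\<^bsub>Heis\<^esub> (r j)" for j
  have rq: "hmult (hmult g (r j)) (q j) = g" for g j
    using group.inv_solve_right[OF group_Heis, of g "hmult g (r j)" "r j"] by (simp add: q_def)
  have rvec_smult: "rvec (c *s v) = real_of_int c *\<^sub>R rvec v" for c and v :: "int ^ 'n"
    by (simp add: rvec_def vec_eq_iff)
  have hr: "horiz (r j) = (2 * real j * norm w) *\<^sub>R e" "height (r j) = 0" for j
  proof -
    have "horiz (r j) = (2 * real j) *\<^sub>R w" by (simp add: r_def w rvec_smult)
    then show "horiz (r j) = (2 * real j * norm w) *\<^sub>R e" using we by (metis scaleR_scaleR)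
    show "height (r j) = 0" by (simp add: r_def rvec_smult inner_rvec power2_eq_square)
  qed
  have "\<forall>j\<in>UNIV. \<exists>p\<in>P \<times> P. fst p \<noteq> snd p \<and> base \<subseteq> close \<epsilon> (T (q j) (fst p)) (T (q j) (snd p))"
  proof
    fix j
    have "inj_on (T (q j)) P" using inj_T P(2) by (rule inj_on_subset)
    then have "N < card (T (q j) ` P)" using P(3) by (simp add: card_image)
    moreover have "T (q j) ` P \<subseteq> X" using P(2) T_in by blast
    ultimately obtain a b where "a \<in> P" "b \<in> P" "T (q j) a \<noteq> T (q j) b" "base \<subseteq> close \<epsilon> (T (q j) a) (T (q j) b)"
      using N[of "T (q j) ` P"] P(1) by auto
    then show "\<exists>p\<in>P \<times> P. fst p \<noteq> snd p \<and> base \<subseteq> close \<epsilon> (T (q j) (fst p)) (T (q j) (snd p))"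
      by (intro bexI[of _ "(a, b)"]) auto
  qed
  \<comment> \<open>There are infinitely many \<open>j\<close> but only finitely many pairs in
    \<open>P \<times> P\<close>.\<close>
  then have "\<exists>p\<in>P \<times> P. infinite {j\<in>UNIV. fst p \<noteq> snd p \<and> base \<subseteq> close \<epsilon> (T (q j) (fst p)) (T (q j) (snd p))}"
    using P(1) by (intro pigeonhole_infinite_rel) auto
  then obtain p where p: "p \<in> P \<times> P"
    "infinite {j\<in>UNIV. fst p \<noteq> snd p \<and> base \<subseteq> close \<epsilon> (T (q j) (fst p)) (T (q j) (snd p))}" by blast
  define a b where "a = fst p" and "b = snd p"
  have ab: "a \<in> P" "b \<in> P" using p(1) by (auto simp: a_def b_def)
  have inf: "infinite {j. a \<noteq> b \<and> base \<subseteq> close \<epsilon> (T (q j) a) (T (q j) b)}"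
    using p(2) by (simp only: a_def b_def UNIV_I simp_thms)
  have X: "a \<in> X" "b \<in> X" using ab P(2) by blast+
  have eq: "\<pi> a = \<pi> b" using ab P(4) by blast
  have ne: "a \<noteq> b"
  proof
    assume "a = b"
    then have "{j. a \<noteq> b \<and> base \<subseteq> close \<epsilon> (T (q j) a) (T (q j) b)} = {}" by blast
    with inf show False by (simp only: finite.emptyI not_True_eq_False)
  qed
  have G: "filled e (inverse (real (Suc n))) (real (Suc n)) (close \<epsilon> a b)" using fil X eq by blast
  have "g \<in> close \<epsilon> a b" for g
  proof (rule fill_everything[OF G])
    fix g assume g: "lens g < M"
    \<comment> \<open>For large \<open>j\<close>, right translation by \<open>r j\<close> moves
      \<open>g\<close> into \<open>0 \<le> fwd\<close>, where \<open>fill_forward\<close> applies to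
      the translated closeness set.\<close>
    obtain m :: nat where m: "- fwd g / (2 * norm w) \<le> real m" using real_arch_simple by blast
    obtain j where j: "m \<le> j" "base \<subseteq> close \<epsilon> (T (q j) a) (T (q j) b)"
      using inf unfolding infinite_nat_iff_unbounded_le by blast
    have "- fwd g \<le> 2 * real m * norm w" using m w(2) by (simp add: field_simps)
    also have "\<dots> \<le> 2 * real j * norm w" using j(1) by (intro mult_right_mono) auto
    finally have "0 \<le> fwd (hmult g (r j))" using shift_fwd(1)[OF hr] by simp
    moreover have "lens (hmult g (r j)) < M" using shift_fwd(2)[OF hr] g by simp
    moreover have "filled e (inverse (real (Suc n))) (real (Suc n)) {g. hmult g (q j) \<in> close \<epsilon> a b}"
      by (rule filled_translate[OF G])
    moreover have "base \<subseteq> {g. hmult g (q j) \<in> close \<epsilon> a b}" using j(2) X by (simp add: close_T)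
    ultimately have "hmult g (r j) \<in> {g. hmult g (q j) \<in> close \<epsilon> a b}" using fill_forward by blast
    then show "g \<in> close \<epsilon> a b" by (simp add: rq)
  qed
  \<comment> \<open>A pair close everywhere makes every unit vector nondeterministic, in particular
    the excluded \<open>- e\<close>.\<close>
  then have "- e \<in> directions \<epsilon>" using X ne eq e by (intro directions_all[of a b]) auto
  then have "\<not> - e \<bullet> e \<le> 0" by (rule none')
  then show False by simp
qed

text \<open>Directions for the individual \<open>\<epsilon>\<close> form nested nonempty compact
  sets, so a single one works for all.\<close>

lemma common_direction:
  assumes w: "w = horiz (wv, wu, 0)" "w \<noteq> 0"
    and fibers: "\<And>M::nat. \<exists>P. finite P \<and> P \<subseteq> X \<and> M < card P \<and> (\<forall>a\<in>P. \<forall>b\<in>P. \<pi> a = \<pi> b)"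
  shows "\<exists>\<nu>. \<nu> \<bullet> w \<le> 0 \<and> (\<forall>\<epsilon>>0. \<nu> \<in> directions \<epsilon>)"
proof -
  define K where "K n = directions (inverse (real (Suc n))) \<inter> {\<nu>. \<nu> \<bullet> w \<le> 0}" for n
  have "\<Inter> (range K) \<noteq> {}"
  proof (rule compact_nest)
    fix n
    have "closed {\<nu>. \<nu> \<bullet> w \<le> 0}"
      using closed_halfspace_le[of w 0] by (simp add: inner_commute)
    moreover have "closed (directions (inverse (real (Suc n))))" by (rule closed_directions) simp
    moreover have "bounded (directions (inverse (real (Suc n))))"
      unfolding bounded_iff directions_def by (intro exI[of _ 1]) auto
    ultimately show "compact (K n)" unfolding K_def compact_eq_bounded_closed
      by (auto intro: bounded_subset)
    show "K n \<noteq> {}" using directions_halfspace[OF _ w fibers, of "inverse (real (Suc n))"] by (auto simp: K_def)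
  next
    fix m n :: nat assume "m \<le> n"
    then have "inverse (real (Suc n)) \<le> inverse (real (Suc m))" by (intro le_imp_inverse_le) auto
    then show "K n \<subseteq> K m" unfolding K_def using directions_mono by blast
  qed
  then obtain \<nu> where \<nu>: "\<And>n. \<nu> \<in> K n" by auto
  have "\<nu> \<in> directions \<epsilon>" if pos: "0 < \<epsilon>" for \<epsilon>
  proof -
    obtain n where n: "inverse (real (Suc n)) < \<epsilon>" using reals_Archimedean[OF pos] by (rule exE)
    have "\<nu> \<in> directions (inverse (real (Suc n)))" using \<nu>[of n] by (simp add: K_def)
    then show ?thesis using directions_mono[OF less_imp_le[OF n]] by (rule subsetD[rotated])
  qed
  moreover have "\<nu> \<bullet> w \<le> 0" using \<nu>[of 0] by (simp add: K_def)
  ultimately show ?thesis by blast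
qed

text \<open>A continuous image of a compact set in the Hausdorff space of functions with pointwise
  convergence.\<close>

lemma closed_busemann_directions:
  assumes "0 < \<epsilon>" shows "closed (busemann ` directions \<epsilon>)"
proof -
  have "bounded (directions \<epsilon>)" unfolding bounded_iff directions_def by (intro exI[of _ 1]) auto
  then have "compact (directions \<epsilon>)" using closed_directions[OF assms] by (simp add: compact_eq_bounded_closed)
  moreover have "continuous_on (directions \<epsilon>) (busemann :: _ \<Rightarrow> 'n heis \<Rightarrow> real)"
    unfolding busemann_def by (intro continuous_on_coordinatewise_then_product continuous_intros)
  ultimately show ?thesis by (intro compact_imp_closed compact_continuous_image)
qed

end

section \<open>Transfer to Busemann horofunctions\<close>

theorem theorem4p9:
  fixes X :: "'x::metric_space set" and T :: "('n::finite) heis \<Rightarrow> 'x \<Rightarrow> 'x"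
    and Y :: "'y::metric_space set" and S :: "'n heis \<Rightarrow> 'y \<Rightarrow> 'y"
    and \<pi> :: "'x \<Rightarrow> 'y"
  assumes "heis_tds X T"
    and "heis_tds Y S"
    and "factor_map X T Y S \<pi>"
    and "\<not> bounded_to_one X Y \<pi>"
  shows "(\<forall>\<epsilon>>0. closedin (top_of_set border) (ND_eps X T \<pi> \<epsilon> \<inter> busemann_border) \<and>
                 ND_eps X T \<pi> \<epsilon> \<inter> busemann_border \<noteq> {}) \<and>
         (closedin (top_of_set border) (ND X T \<pi> \<inter> busemann_border) \<and>
          ND X T \<pi> \<inter> busemann_border \<noteq> {}) \<and>
         (\<Inter>h\<in>ND X T \<pi> \<inter> busemann_border. {g. h g < 0}) = {}"
proof -
  interpret heis_fibers X T \<pi>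
  proof (intro heis_fibers.intro heis_fibers_axioms.intro)
    show "continuous_on X \<pi>" using assms(3) by (simp add: factor_map_def)
    show "\<pi> (T g x) = \<pi> (T g y)" if "x \<in> X" "y \<in> X" "\<pi> x = \<pi> y" for g x y
      using assms(3) that unfolding factor_map_def by metis
  qed (rule assms(1))
  have fibers: "\<exists>P. finite P \<and> P \<subseteq> X \<and> M < card P \<and> (\<forall>a\<in>P. \<forall>b\<in>P. \<pi> a = \<pi> b)" for M :: nat
  proof -
    obtain y where y: "\<not> (finite {x\<in>X. \<pi> x = y} \<and> card {x\<in>X. \<pi> x = y} \<le> M)"
      using assms(4) unfolding bounded_to_one_def by blast
    have "\<exists>P\<subseteq>{x\<in>X. \<pi> x = y}. finite P \<and> card P = Suc M"
    proof (cases "finite {x\<in>X. \<pi> x = y}")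
      case True
      then have "Suc M \<le> card {x\<in>X. \<pi> x = y}" using y by simp
      then obtain P where "P \<subseteq> {x\<in>X. \<pi> x = y}" "card P = Suc M" "finite P"
        by (rule obtain_subset_with_card_n)
      then show ?thesis by blast
    next
      case False
      then show ?thesis using infinite_arbitrarily_large[of "{x\<in>X. \<pi> x = y}" "Suc M"] by blast
    qed
    then obtain P where P: "P \<subseteq> {x\<in>X. \<pi> x = y}" "finite P" "card P = Suc M" by blast
    then show ?thesis by (intro exI[of _ P]) auto
  qed
  have ND_I: "busemann \<nu> \<in> ND X T \<pi> \<inter> busemann_border" if "\<forall>\<epsilon>>0. \<nu> \<in> directions \<epsilon>" for \<nu>
  proof -
    have *: "busemann \<nu> \<in> ND_eps X T \<pi> \<epsilon> \<inter> busemann_border" if "0 < \<epsilon>" for \<epsilon>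
      unfolding busemann_ND_eps using \<open>\<forall>\<epsilon>>0. _\<close> that by (intro imageI) blast
    then have "busemann \<nu> \<in> ND X T \<pi>" unfolding ND_def by blast
    with *[of 1] show ?thesis by simp
  qed
  \<comment> \<open>For each \<open>g\<close> this gives a horofunction in the set with
    \<open>g\<close> outside its negative half-space, hence the empty intersection; any one
    \<open>g\<close> gives non-emptiness.\<close>
  have ex: "\<exists>h\<in>ND X T \<pi> \<inter> busemann_border. 0 \<le> h g" for g
  proof -
    have "\<exists>\<nu>. \<nu> \<bullet> horiz g \<le> 0 \<and> (\<forall>\<epsilon>>0. \<nu> \<in> directions \<epsilon>)"
    proof (cases "horiz g = 0")
      case True
      \<comment> \<open>Here \<open>\<nu> \<bullet> horiz g = 0\<close> for every
        \<open>\<nu>\<close>, so an arbitrary nonzero vector is used to obtain one.\<close>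
      have "horiz (1, 1, 0) \<noteq> (0 :: (real ^ 'n) \<times> (real ^ 'n))"
        by (simp add: rvec_def vec_eq_iff prod_eq_iff)
      then show ?thesis using common_direction[OF refl _ fibers, of 1 1] True by auto
    next
      case False
      obtain v u t where g: "g = (v, u, t)" by (cases g)
      have "horiz g = horiz (v, u, 0)" by (simp add: g)
      then show ?thesis using common_direction[OF _ False fibers] by blast
    qed
    then obtain \<nu> where "\<nu> \<bullet> horiz g \<le> 0" "busemann \<nu> \<in> ND X T \<pi> \<inter> busemann_border"
      using ND_I by metis
    then show ?thesis by (intro bexI[of _ "busemann \<nu>"]) (simp add: busemann_def)
  qed
  have cl: "closedin (top_of_set border) (ND_eps X T \<pi> \<epsilon> \<inter> busemann_border)" if "0 < \<epsilon>" for \<epsilon>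
    using closed_busemann_directions[OF that] unfolding busemann_ND_eps[symmetric]
    by (intro closed_subset) (simp_all only: ND_eps_def, blast)
  \<comment> \<open>Intersecting with the fixed set distributes because the index set contains
    \<open>1\<close>.\<close>
  have "ND X T \<pi> \<inter> busemann_border = (\<Inter>\<epsilon>\<in>{0<..}. ND_eps X T \<pi> \<epsilon> \<inter> busemann_border)"
    unfolding ND_def by (metis INT_extend_simps(1) greaterThan_iff empty_iff zero_less_one)
  then have "closedin (top_of_set border) (ND X T \<pi> \<inter> busemann_border)"
    using cl by (simp only:) (intro closedin_INT, auto)
  moreover have "ND X T \<pi> \<inter> busemann_border \<noteq> {}" using ex[of "(0, 0, 0)"] by blast
  moreover have "ND_eps X T \<pi> \<epsilon> \<inter> busemann_border \<noteq> {}" if "0 < \<epsilon>" for \<epsilon>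
    using \<open>ND X T \<pi> \<inter> busemann_border \<noteq> {}\<close> that unfolding ND_def by blast
  moreover have "(\<Inter>h\<in>ND X T \<pi> \<inter> busemann_border. {g. h g < 0}) = {}"
    using ex by (fastforce simp only: not_less[symmetric])
  ultimately show ?thesis using cl by blast
qed

end
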